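(* Let $X$ be a subordinator with drift $\delta>0$ and Lévy measure $\Pi$, let $q\ge0$, and assume that $q>0$ or $\Pi\neq0$. Then for every integer $n\ge0$, $$\sum_{k=0}^{n}\frac{(-1)^k}{\delta^{k+1}}\,\mathbf 1\ast(q+\bar\Pi)^{\ast k}(x)-u^{(q)}(x)\ \sim\ \frac{(-1)^n}{\delta^{n+2}}\,\mathbf 1\ast(q+\bar\Pi)^{\ast(n+1)}(x)\qquad\text{as }x\downarrow0 .$$
   Context: A subordinator is a Lévy process $X=(X_t)_{t\ge0}$ with $X_0=0$ and almost surely non-decreasing paths; $X_t=\delta t+\sum_{s\le t}\Delta_s$ with drift $\delta$ and jumps $\Delta_s$ governed by a Poisson random measure with Lévy measure $\Pi$, a measure on $(0,\infty)$ with $\int_0^\infty(1\wedge x)\,\Pi(dx)<\infty$. The tail of $\Pi$ is $\bar\Pi(x)=\Pi([x,\infty))$ for $x>0$. For $q\ge0$ the $q$-potential measure is $U^{(q)}(dx)=\mathbb{E}\left[\int_0^\infty e^{-qt}\mathbf 1_{\{X_t\in dx\}}\,dt\right]$. When $\delta>0$ it is known to have a bounded continuous density with respect to Lebesgue measure, denoted $u^{(q)}$. Convolution of functions on $(0,\infty)$: $f\ast g(x)=\int_0^xf(x-y)g(y)\,dy$; $f^{\ast k}$ is the $k$-fold convolution; $\mathbf 1$ is the Heaviside function (equal to $1$ on $(0,\infty)$), so $\mathbf 1\ast f^{\ast k}(x)=\int_0^xf^{\ast k}(y)\,dy$ for $k\ge1$, with the convention $\mathbf 1\ast f^{\ast 0}(x)=1$.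 The notation $f\sim g$ means $\lim f/g=1$. *)

theory Defs
  imports "HOL-Probability.Probability"
begin

text \<open>Processes are indexed by \<open>t \<ge> 0\<close>; the values \<open>X t\<close> for negative \<open>t\<close> are never used.\<close>

definition cadlag :: "(real \<Rightarrow> real) \<Rightarrow> bool" where
  "cadlag x \<longleftrightarrow>
     (\<forall>t\<ge>0. continuous (at_right t) x) \<and> (\<forall>t>0. \<exists>l. (x \<longlongrightarrow> l) (at_left t))"

definition levy_process :: "'a measure \<Rightarrow> (real \<Rightarrow> 'a \<Rightarrow> real) \<Rightarrow> bool" where
  "levy_process M X \<longleftrightarrow>
     prob_space M \<and>
     (\<forall>t\<ge>0. X t \<in> borel_measurable M) \<and>
     (AE \<omega> in M. X 0 \<omega> = 0) \<and>
     (AE \<omega> in M. cadlag (\<lambda>t. X t \<omega>)) \<and>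
     (\<forall>s t. 0 \<le> s \<and> s \<le> t \<longrightarrow>
        distr M borel (\<lambda>\<omega>. X t \<omega> - X s \<omega>) = distr M borel (X (t - s))) \<and>
     (\<forall>(n::nat) \<tau>. 0 \<le> \<tau> 0 \<and> mono_on {..n} \<tau> \<longrightarrow>
        prob_space.indep_vars M (\<lambda>_. borel) (\<lambda>i \<omega>. X (\<tau> (Suc i)) \<omega> - X (\<tau> i) \<omega>) {..<n})"

definition subordinator :: "'a measure \<Rightarrow> (real \<Rightarrow> 'a \<Rightarrow> real) \<Rightarrow> bool" where
  "subordinator M X \<longleftrightarrow> levy_process M X \<and> (AE \<omega> in M. mono_on {0..} (\<lambda>t. X t \<omega>))"

text \<open>A measure on \<open>(0,\<infinity>)\<close> is encoded as a Borel measure on the real line that does not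
  charge \<open>(-\<infinity>,0]\<close>.\<close>

definition subordinator_levy_measure :: "real measure \<Rightarrow> bool" where
  "subordinator_levy_measure \<nu> \<longleftrightarrow>
     sets \<nu> = sets borel \<and> emeasure \<nu> {..0} = 0 \<and> (\<integral>\<^sup>+x. ennreal (min 1 x) \<partial>\<nu>) < \<infinity>"

text \<open>The Poisson weights are written out because \<open>poisson_pmf\<close> is only meaningful for positive
  rates, whereas sets of intensity \<open>0\<close> must be allowed here.\<close>

definition poisson_random_measure :: "'a measure \<Rightarrow> 'b measure \<Rightarrow> ('a \<Rightarrow> 'b measure) \<Rightarrow> bool" where
  "poisson_random_measure M \<mu> N \<longleftrightarrow>
     (\<forall>\<omega>\<in>space M. sets (N \<omega>) = sets \<mu>) \<and>
     (\<forall>B\<in>sets \<mu>. (\<lambda>\<omega>. emeasure (N \<omega>) B) \<in> borel_measurable M) \<and>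
     (\<forall>B\<in>sets \<mu>. emeasure \<mu> B < \<infinity> \<longrightarrow>
        (\<forall>k::nat. measure M {\<omega>\<in>space M. emeasure (N \<omega>) B = of_nat k} =
                  exp (- measure \<mu> B) * measure \<mu> B ^ k / fact k)) \<and>
     (\<forall>B\<in>sets \<mu>. emeasure \<mu> B = \<infinity> \<longrightarrow> (AE \<omega> in M. emeasure (N \<omega>) B = \<infinity>)) \<and>
     (\<forall>(n::nat) B. (\<forall>i<n. B i \<in> sets \<mu>) \<and> disjoint_family_on B {..<n} \<longrightarrow>
        prob_space.indep_vars M (\<lambda>_. borel) (\<lambda>i \<omega>. emeasure (N \<omega>) (B i)) {..<n})"

definition path_jump :: "(real \<Rightarrow> real) \<Rightarrow> real \<Rightarrow> real" where
  "path_jump x s = x s - Lim (at_left s) x"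

definition jump_measure :: "(real \<Rightarrow> real) \<Rightarrow> (real \<times> real) measure" where
  "jump_measure x =
     distr (count_space {s. 0 < s \<and> path_jump x s \<noteq> 0}) (borel \<Otimes>\<^sub>M borel) (\<lambda>s. (s, path_jump x s))"

text \<open>\<open>X\<^sub>t = \<delta> t + (\<Sum>s\<le>t. \<Delta>\<^sub>s)\<close>, where the point measure of the pairs \<open>(s, \<Delta>\<^sub>s)\<close> is a Poisson random
  measure with intensity \<open>ds \<otimes> \<nu>(dx)\<close> on \<open>(0,\<infinity>)\<^sup>2\<close>.  The random measure \<open>N\<close> is a version of the jump
  measure: paths are regular only almost surely, so the jump measure itself need not be measurable
  on the exceptional null set.\<close>

definition has_drift_and_levy_measure ::
    "'a measure \<Rightarrow> (real \<Rightarrow> 'a \<Rightarrow> real) \<Rightarrow> real \<Rightarrow> real measure \<Rightarrow> bool" where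
  "has_drift_and_levy_measure M X \<delta> \<nu> \<longleftrightarrow>
     subordinator_levy_measure \<nu> \<and>
     (\<exists>N. poisson_random_measure M (density lborel (indicator {0<..}) \<Otimes>\<^sub>M \<nu>) N \<and>
          (AE \<omega> in M. N \<omega> = jump_measure (\<lambda>t. X t \<omega>))) \<and>
     (AE \<omega> in M. \<forall>t\<ge>0.
        (path_jump (\<lambda>r. X r \<omega>) has_sum (X t \<omega> - \<delta> * t)) {0<..t})"

definition levy_tail :: "real measure \<Rightarrow> real \<Rightarrow> real" where
  "levy_tail \<nu> x = measure \<nu> {x..}"

definition potential_measure :: "'a measure \<Rightarrow> (real \<Rightarrow> 'a \<Rightarrow> real) \<Rightarrow> real \<Rightarrow> real measure" where
  "potential_measure M X q = measure_of UNIV (sets borel)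
     (\<lambda>A. \<integral>\<^sup>+\<omega>. (\<integral>\<^sup>+t. ennreal (exp (- q * t)) * indicator A (X t \<omega>) * indicator {0..} t \<partial>lborel) \<partial>M)"

definition is_potential_density ::
    "'a measure \<Rightarrow> (real \<Rightarrow> 'a \<Rightarrow> real) \<Rightarrow> real \<Rightarrow> (real \<Rightarrow> real) \<Rightarrow> bool" where
  "is_potential_density M X q u \<longleftrightarrow>
     continuous_on {0<..} u \<and> bounded (u ` {0<..}) \<and> (\<forall>x>0. 0 \<le> u x) \<and>
     potential_measure M X q = density lborel (\<lambda>x. ennreal (u x) * indicator {0<..} x)"

text \<open>The predicate determines \<open>u\<close> on \<open>(0,\<infinity>)\<close>, so the choice below is immaterial there.\<close>

definition potential_density :: "'a measure \<Rightarrow> (real \<Rightarrow> 'a \<Rightarrow> real) \<Rightarrow> real \<Rightarrow> real \<Rightarrow> real" where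
  "potential_density M X q = (SOME u. is_potential_density M X q u)"

definition conv :: "(real \<Rightarrow> real) \<Rightarrow> (real \<Rightarrow> real) \<Rightarrow> real \<Rightarrow> real" where
  "conv f g x = (LINT y:{0<..<x}|lborel. f (x - y) * g y)"

text \<open>\<open>conv_power_Suc f k\<close> is the convolution power with \<open>k + 1\<close> factors; the power with no factor is
  not a function.\<close>

primrec conv_power_Suc :: "(real \<Rightarrow> real) \<Rightarrow> nat \<Rightarrow> real \<Rightarrow> real" where
  "conv_power_Suc f 0 = f"
| "conv_power_Suc f (Suc k) = conv f (conv_power_Suc f k)"

definition heaviside :: "real \<Rightarrow> real" where
  "heaviside = indicator {0<..}"

fun heaviside_conv_power :: "(real \<Rightarrow> real) \<Rightarrow> nat \<Rightarrow> real \<Rightarrow> real" where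
  "heaviside_conv_power f 0 = (\<lambda>x. 1)"
| "heaviside_conv_power f (Suc k) = conv heaviside (conv_power_Suc f k)"

end

theory Submission
  imports Defs
begin

text \<open>
  Write \<open>g = q + levy_tail \<nu>\<close> and let \<open>u\<close> be the \<open>q\<close>-potential density.  Everything rests on the renewal
  equation \<open>\<delta> u + g * u = 1\<close> on \<open>(0,\<infinity>)\<close>.  Solving it for \<open>u\<close> and substituting the result into itself
  produces the alternating sum with the exact remainder
  \<open>(-1)^n / \<delta>^(n+1) (g^{*(n+1)} * u)(x)\<close>.  The equation also gives \<open>(1 - H x / \<delta>) / \<delta> \<le> u \<le> 1 / \<delta>\<close> on
  \<open>(0,x)\<close>, where \<open>H x\<close> is the integral of \<open>g\<close> over \<open>(0,x)\<close> and vanishes as \<open>x \<down> 0\<close>; so \<open>u\<close> may be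
  replaced by \<open>1 / \<delta>\<close> in the remainder, and this is the claim.  That part is pure analysis
  (\<open>renewal_expansion\<close>).

  The renewal equation is an identity of Laplace transforms.  The jumps form a Poisson random measure, whose
  Laplace functional (\<open>prm_laplace_functional\<close>) yields
  \<open>E exp (-l X_t) = exp (-t l (\<delta> + L l))\<close> with \<open>L\<close> the Laplace transform of the tail
  (\<open>subordinator_laplace_transform\<close>).  Integrating over \<open>t\<close> with weight \<open>exp (-q t)\<close>, the potential
  measure \<open>U\<close> has transform \<open>1 / (q + l (\<delta> + L l))\<close>, and since \<open>g\<close> has transform \<open>q / l + L l\<close>, the measure
  \<open>\<delta> U + (U * g) dx\<close> has transform \<open>1 / l\<close>.  Uniqueness of the Laplace transform identifies it with Lebesgue
  measure on \<open>(0,\<infinity>)\<close> (\<open>potential_renewal_measure\<close>).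

  Hence \<open>U\<close> is absolutely continuous with a density bounded by \<open>1 / \<delta>\<close>.  Its continuity follows from
  that of \<open>g * u\<close>, where monotonicity of \<open>g\<close> supplies the explicit modulus of continuity \<open>H / \<delta>\<close>
  (\<open>enn2real_nconv_continuous\<close>); two continuous densities coincide, so \<open>potential_density\<close> satisfies the
  renewal equation at every point of \<open>(0,\<infinity>)\<close>.
\<close>

section \<open>Convolution on the half-line\<close>

text \<open>Convolution over the whole line with values in \<open>ennreal\<close>: Tonelli makes it associative without any
  integrability condition.  Functions on \<open>(0,\<infinity>)\<close> enter through their extension by zero, \<open>pos_ext\<close>.\<close>

definition nconv :: "(real \<Rightarrow> ennreal) \<Rightarrow> (real \<Rightarrow> ennreal) \<Rightarrow> real \<Rightarrow> ennreal" where
  "nconv F G x = (\<integral>\<^sup>+y. F (x - y) * G y \<partial>lborel)"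

definition pos_ext :: "(real \<Rightarrow> real) \<Rightarrow> real \<Rightarrow> ennreal" where
  "pos_ext f x = ennreal (f x) * indicator {0<..} x"

primrec nconv_power_Suc :: "(real \<Rightarrow> ennreal) \<Rightarrow> nat \<Rightarrow> real \<Rightarrow> ennreal" where
  "nconv_power_Suc G 0 = G"
| "nconv_power_Suc G (Suc k) = nconv G (nconv_power_Suc G k)"

abbreviation unit_step :: "real \<Rightarrow> ennreal" where
  "unit_step \<equiv> indicator {0<..}"

lemma pos_ext_le_0 [simp]: "x \<le> 0 \<Longrightarrow> pos_ext f x = 0"
  by (simp add: pos_ext_def)

lemma pos_ext_gt_0: "x > 0 \<Longrightarrow> pos_ext f x = ennreal (f x)"
  by (simp add: pos_ext_def)

lemma pos_ext_heaviside: "pos_ext heaviside = unit_step"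
  by (auto simp: pos_ext_def heaviside_def indicator_def fun_eq_iff)

lemma measurable_nconv [measurable]:
  assumes [measurable]: "F \<in> borel_measurable borel" "G \<in> borel_measurable borel"
  shows "nconv F G \<in> borel_measurable borel"
  unfolding nconv_def by measurable

lemma nconv_commute:
  assumes [measurable]: "F \<in> borel_measurable borel" "G \<in> borel_measurable borel"
  shows "nconv F G = nconv G F"
proof
  fix x
  have "nconv F G x = ennreal \<bar>- 1\<bar> * (\<integral>\<^sup>+y. F (x - (x + (- 1) * y)) * G (x + (- 1) * y) \<partial>lborel)"
    unfolding nconv_def by (rule nn_integral_real_affine) auto
  then show "nconv F G x = nconv G F x"
    by (simp add: nconv_def mult.commute)
qed

lemma nconv_assoc:
  assumes [measurable]: "F \<in> borel_measurable borel" "G \<in> borel_measurable borel"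
    "K \<in> borel_measurable borel"
  shows "nconv (nconv F G) K = nconv F (nconv G K)"
proof
  fix x
  have "nconv (nconv F G) K x = (\<integral>\<^sup>+y. (\<integral>\<^sup>+z. F (x - y - z) * G z \<partial>lborel) * K y \<partial>lborel)"
    by (simp add: nconv_def)
  also have "\<dots> = (\<integral>\<^sup>+y. (\<integral>\<^sup>+z. F (x - z) * G (z - y) \<partial>lborel) * K y \<partial>lborel)"
  proof (rule nn_integral_cong)
    fix y
    have "(\<integral>\<^sup>+z. F (x - y - z) * G z \<partial>lborel)
        = ennreal \<bar>1\<bar> * (\<integral>\<^sup>+z. F (x - y - (- y + 1 * z)) * G (- y + 1 * z) \<partial>lborel)"
      by (rule nn_integral_real_affine) auto
    then show "(\<integral>\<^sup>+z. F (x - y - z) * G z \<partial>lborel) * K y = (\<integral>\<^sup>+z. F (x - z) * G (z - y) \<partial>lborel) * K y"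
      by (simp add: algebra_simps)
  qed
  also have "\<dots> = (\<integral>\<^sup>+y. (\<integral>\<^sup>+z. F (x - z) * G (z - y) * K y \<partial>lborel) \<partial>lborel)"
    by (simp add: nn_integral_multc)
  also have "\<dots> = (\<integral>\<^sup>+z. (\<integral>\<^sup>+y. F (x - z) * G (z - y) * K y \<partial>lborel) \<partial>lborel)"
    by (rule lborel_pair.Fubini') measurable
  also have "\<dots> = nconv F (nconv G K) x"
    by (simp add: nconv_def nn_integral_cmult mult.assoc)
  finally show "nconv (nconv F G) K x = nconv F (nconv G K) x" .
qed

lemma nconv_left_commute:
  assumes [measurable]: "F \<in> borel_measurable borel" "G \<in> borel_measurable borel"
    "K \<in> borel_measurable borel"
  shows "nconv F (nconv G K) = nconv G (nconv F K)"
proof -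
  have "nconv F (nconv G K) = nconv (nconv F G) K"
    by (rule nconv_assoc[symmetric]) measurable
  also have "nconv F G = nconv G F"
    by (rule nconv_commute) measurable
  also have "nconv (nconv G F) K = nconv G (nconv F K)"
    by (rule nconv_assoc) measurable
  finally show ?thesis .
qed

lemma nconv_AE_cong:
  "AE y in lborel. G y = G' y \<Longrightarrow> nconv F G x = nconv F G' x"
  unfolding nconv_def by (intro nn_integral_cong_AE) auto

lemma nconv_add_right:
  assumes [measurable]: "F \<in> borel_measurable borel" "G \<in> borel_measurable borel"
    "K \<in> borel_measurable borel"
  shows "nconv F (\<lambda>y. G y + K y) x = nconv F G x + nconv F K x"
  by (simp add: nconv_def distrib_left nn_integral_add)

lemma nconv_cmult_right:
  assumes [measurable]: "F \<in> borel_measurable borel" "G \<in> borel_measurable borel"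
  shows "nconv F (\<lambda>y. c * G y) x = c * nconv F G x"
  by (simp add: nconv_def mult.left_commute nn_integral_cmult)

lemma nconv_unit_step: "nconv F unit_step x = (\<integral>\<^sup>+y. F (x - y) * indicator {0<..} y \<partial>lborel)"
  by (simp add: nconv_def)

lemma unit_step_nconv: "nconv unit_step G x = (\<integral>\<^sup>+y. G y * indicator {..<x} y \<partial>lborel)"
  unfolding nconv_def by (intro nn_integral_cong) (auto simp: indicator_def)

lemma unit_step_nconv_mono: "x \<le> y \<Longrightarrow> nconv unit_step G x \<le> nconv unit_step G y"
  unfolding unit_step_nconv by (intro nn_integral_mono) (auto simp: indicator_def)

lemma nconv_eq_0_left_half:
  assumes "\<And>x. x \<le> 0 \<Longrightarrow> F x = 0" "\<And>x. x \<le> 0 \<Longrightarrow> G x = 0" "x \<le> 0"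
  shows "nconv F G x = 0"
proof -
  have eq: "F (x - y) * G y = 0" for y
    by (cases "y \<le> 0") (use assms in auto)
  have "(\<lambda>y. F (x - y) * G y) = (\<lambda>_. 0)"
    by (rule ext) (rule eq)
  then show ?thesis by (simp only: nconv_def nn_integral_const mult_zero_left)
qed

text \<open>At \<open>x\<close> the convolution only sees the values of its factors on \<open>(0,x)\<close>, so a local bound on \<open>G\<close> suffices.\<close>

lemma nconv_le_of_bounded:
  assumes [measurable]: "F \<in> borel_measurable borel" "G \<in> borel_measurable borel"
    and F: "\<And>x. x \<le> 0 \<Longrightarrow> F x = 0" and G: "\<And>x. x \<le> 0 \<Longrightarrow> G x = 0"
    and le: "\<And>y. 0 < y \<Longrightarrow> y < x \<Longrightarrow> G y \<le> C"
  shows "nconv F G x \<le> C * nconv unit_step F x"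
proof -
  have "nconv F G x \<le> (\<integral>\<^sup>+y. C * (F (x - y) * indicator {0<..} y) \<partial>lborel)"
    unfolding nconv_def
  proof (rule nn_integral_mono)
    fix y
    show "F (x - y) * G y \<le> C * (F (x - y) * indicator {0<..} y)"
    proof (cases "0 < y \<and> y < x")
      case True
      then show ?thesis using mult_left_mono[OF le, of y "F (x - y)"] by (simp add: mult.commute)
    next
      case False
      then show ?thesis using F[of "x - y"] G[of y] by fastforce
    qed
  qed
  also have "\<dots> = C * nconv F unit_step x"
    by (simp add: nconv_unit_step nn_integral_cmult)
  also have "nconv F unit_step = nconv unit_step F"
    by (rule nconv_commute) measurable
  finally show ?thesis .
qed

lemma nconv_pos:
  assumes [measurable]: "F \<in> borel_measurable borel" "G \<in> borel_measurable borel"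
    and F: "\<And>y. 0 < y \<Longrightarrow> y < c \<Longrightarrow> F y > 0" and G: "\<And>y. 0 < y \<Longrightarrow> y < c \<Longrightarrow> G y > 0"
    and x: "0 < x" "x < c"
  shows "nconv F G x > 0"
proof (rule ccontr)
  assume "\<not> nconv F G x > 0"
  then have "AE y in lborel. F (x - y) * G y = 0"
    by (simp add: nconv_def nn_integral_0_iff_AE)
  moreover have "F (x - y) * G y \<noteq> 0" if "y \<in> {0<..<x}" for y
    using F[of "x - y"] G[of y] x that by auto
  ultimately have "AE y in lborel. y \<notin> {0<..<x}"
    by (auto elim!: eventually_mono)
  then have "emeasure lborel {0<..<x} = 0"
    by (subst (asm) AE_iff_measurable[where N="{0<..<x}"]) auto
  with x show False by simp
qed

text \<open>A divergent integral is no exception: the left side is then a Bochner integral of a non-integrable function, hence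
  \<open>0\<close>, and so is \<open>enn2real \<infinity>\<close>.\<close>

lemma conv_eq_nconv:
  assumes [measurable]: "pos_ext f \<in> borel_measurable borel" "pos_ext g \<in> borel_measurable borel"
    and f: "\<And>x. x > 0 \<Longrightarrow> f x \<ge> 0" and g: "\<And>x. x > 0 \<Longrightarrow> g x \<ge> 0"
  shows "conv f g x = enn2real (nconv (pos_ext f) (pos_ext g) x)"
proof -
  let ?k = "\<lambda>y. pos_ext f (x - y) * pos_ext g y"
  have k: "indicator {0<..<x} y *\<^sub>R (f (x - y) * g y) = enn2real (?k y)" for y
    using f[of "x - y"] g[of y] by (auto simp: pos_ext_def indicator_def enn2real_mult)
  have fin: "ennreal (enn2real (?k y)) = ?k y" for y
    by (auto simp: pos_ext_def indicator_def ennreal_mult_less_top)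
  have "conv f g x = (LINT y|lborel. enn2real (?k y))"
    by (simp only: conv_def set_lebesgue_integral_def k)
  also have "\<dots> = enn2real (\<integral>\<^sup>+y. ennreal (enn2real (?k y)) \<partial>lborel)"
    by (intro integral_eq_nn_integral) auto
  also have "\<dots> = enn2real (nconv (pos_ext f) (pos_ext g) x)"
    by (simp only: fin nconv_def)
  finally show ?thesis .
qed

lemma conv_nonneg:
  assumes "\<And>x. x > 0 \<Longrightarrow> f x \<ge> 0" "\<And>x. x > 0 \<Longrightarrow> g x \<ge> 0"
  shows "conv f g x \<ge> 0"
  unfolding conv_def set_lebesgue_integral_def
  by (intro integral_nonneg_AE AE_I2) (auto simp: indicator_def assms)

section \<open>Asymptotic expansion of solutions of a renewal equation\<close>

context
  fixes g :: "real \<Rightarrow> real"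
  assumes meas [measurable]: "pos_ext g \<in> borel_measurable borel"
    and nonneg: "\<And>x. x > 0 \<Longrightarrow> g x \<ge> 0"
    and fin: "\<And>x. nconv unit_step (pos_ext g) x < \<infinity>"
begin

lemma measurable_nconv_power_Suc [measurable]:
  "nconv_power_Suc (pos_ext g) k \<in> borel_measurable borel"
  by (induction k) (auto intro: meas measurable_nconv)

lemma nconv_power_Suc_le_0: "x \<le> 0 \<Longrightarrow> nconv_power_Suc (pos_ext g) k x = 0"
  by (induction k arbitrary: x) (auto intro!: nconv_eq_0_left_half)

lemma unit_step_nconv_power_finite: "nconv unit_step (nconv_power_Suc (pos_ext g) k) x < \<infinity>"
proof (induction k arbitrary: x)
  case (Suc k)
  let ?P = "nconv_power_Suc (pos_ext g) k"
  have "nconv unit_step (nconv_power_Suc (pos_ext g) (Suc k)) x = nconv (pos_ext g) (nconv unit_step ?P) x"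
    unfolding nconv_power_Suc.simps by (rule fun_cong[OF nconv_left_commute]) measurable
  also have "\<dots> \<le> nconv unit_step ?P x * nconv unit_step (pos_ext g) x"
    by (rule nconv_le_of_bounded)
      (auto intro!: unit_step_nconv_mono nconv_eq_0_left_half simp: nconv_power_Suc_le_0)
  also have "\<dots> < \<infinity>"
    using Suc fin by (simp add: ennreal_mult_less_top)
  finally show ?case .
qed (use fin in simp)

lemma nconv_power_Suc_AE_finite: "AE x in lborel. nconv_power_Suc (pos_ext g) k x < \<infinity>"
proof -
  let ?P = "nconv_power_Suc (pos_ext g) k"
  have "AE y in lborel. ?P y * indicator {..<real n} y < \<infinity>" for n
    using unit_step_nconv_power_finite[of k "real n"]
    unfolding unit_step_nconv
    by (intro nn_integral_noteq_infinite[THEN eventually_mono]) (auto simp: less_top)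
  then have "AE y in lborel. \<forall>n. ?P y * indicator {..<real n} y < \<infinity>"
    by (simp add: AE_all_countable)
  then show ?thesis
  proof (eventually_elim)
    case (elim y)
    obtain n where "y < real n" using reals_Archimedean2 by blast
    with elim[rule_format, of n] show ?case by simp
  qed
qed

lemma conv_power_Suc_nonneg: "x > 0 \<Longrightarrow> conv_power_Suc g k x \<ge> 0"
  by (induction k arbitrary: x) (auto intro!: conv_nonneg nonneg)

text \<open>The convolution powers of \<open>g\<close> might be infinite on a null set, where the real-valued ones default to zero.
  One more integration makes the discrepancy invisible, so agreement almost everywhere is enough.\<close>

lemma conv_power_Suc_eq_nconv_power:
  shows "pos_ext (conv_power_Suc g k) \<in> borel_measurable borel"
    and "AE x in lborel. pos_ext (conv_power_Suc g k) x = nconv_power_Suc (pos_ext g) k x"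
proof (induction k)
  case (Suc k)
  note [measurable] = Suc(1)
  have eq: "conv_power_Suc g (Suc k) x = enn2real (nconv_power_Suc (pos_ext g) (Suc k) x)" for x
    using nconv_AE_cong[OF Suc(2)]
    by (simp add: conv_eq_nconv nonneg conv_power_Suc_nonneg)
  have ext: "pos_ext (conv_power_Suc g (Suc k))
      = (\<lambda>x. ennreal (enn2real (nconv_power_Suc (pos_ext g) (Suc k) x)) * indicator {0<..} x)"
    using eq by (simp add: pos_ext_def fun_eq_iff)
  {
    case 1
    show ?case unfolding ext by measurable
  next
    case 2
    show ?case using nconv_power_Suc_AE_finite[of "Suc k"] unfolding ext
    proof eventually_elim
      case (elim x)
      then show ?case
        using nconv_power_Suc_le_0[of x "Suc k"] by (cases "x > 0") (auto simp: less_top)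
    qed
  }
qed auto

lemma heaviside_conv_power_Suc_eq:
  "heaviside_conv_power g (Suc k) x = enn2real (nconv unit_step (nconv_power_Suc (pos_ext g) k) x)"
proof -
  note [measurable] = conv_power_Suc_eq_nconv_power(1)
  have "heaviside_conv_power g (Suc k) x
      = enn2real (nconv (pos_ext heaviside) (pos_ext (conv_power_Suc g k)) x)"
    unfolding heaviside_conv_power.simps
    by (rule conv_eq_nconv)
      (simp_all add: pos_ext_heaviside conv_power_Suc_nonneg, simp add: heaviside_def)
  also have "\<dots> = enn2real (nconv unit_step (nconv_power_Suc (pos_ext g) k) x)"
    by (simp only: pos_ext_heaviside nconv_AE_cong[OF conv_power_Suc_eq_nconv_power(2)])
  finally show ?thesis .
qed

lemma unit_step_nconv_tendsto_0:
  "((\<lambda>x. enn2real (nconv unit_step (pos_ext g) x)) \<longlongrightarrow> 0) (at_right 0)"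
proof -
  let ?N = "density lborel (pos_ext g)"
  let ?H = "nconv unit_step (pos_ext g)"
  have H: "?H x = emeasure ?N {0<..<x}" for x
    unfolding unit_step_nconv
    by (subst emeasure_density) (auto intro!: nn_integral_cong simp: indicator_def)
  have "(\<lambda>n. emeasure ?N {0<..<1 / real (Suc n)}) \<longlonglongrightarrow> emeasure ?N (\<Inter>n. {0<..<1 / real (Suc n)})"
  proof (rule Lim_emeasure_decseq)
    show "decseq (\<lambda>n. {0<..<1 / real (Suc n)})"
    proof (intro decseq_SucI subsetI)
      fix n x assume "x \<in> {0<..<1 / real (Suc (Suc n))}"
      moreover have "1 / real (Suc (Suc n)) \<le> 1 / real (Suc n)" by (simp add: field_simps)
      ultimately show "x \<in> {0<..<1 / real (Suc n)}" by simp
    qed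
    show "emeasure ?N {0<..<1 / real (Suc n)} \<noteq> \<infinity>" for n
      using fin[of "1 / real (Suc n)"] by (simp add: H)
  qed auto
  also have "(\<Inter>n. {0<..<1 / real (Suc n)}) = {}"
  proof (intro equals0I)
    fix x assume x: "x \<in> (\<Inter>n. {0<..<1 / real (Suc n)})"
    then have "x > 0" by auto
    then obtain n where "inverse (real (Suc n)) < x" using reals_Archimedean by blast
    moreover have "x < 1 / real (Suc n)"
      using INT_D[OF x UNIV_I, of n] by (simp only: greaterThanLessThan_iff)
    ultimately show False by (simp add: inverse_eq_divide)
  qed
  finally have lim: "(\<lambda>n. ?H (1 / real (Suc n))) \<longlonglongrightarrow> 0" by (simp add: H)
  have lim0: "(\<lambda>n. enn2real (?H (1 / real (Suc n)))) \<longlonglongrightarrow> 0"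
    by (rule tendsto_enn2real) (use lim in auto)
  show ?thesis
  proof (rule order_tendstoI)
    fix e :: real assume "e < 0"
    then show "\<forall>\<^sub>F x in at_right 0. e < enn2real (?H x)"
      using less_le_trans[OF _ enn2real_nonneg] by (intro always_eventually allI) blast
  next
    fix e :: real assume "e > 0"
    have "\<forall>\<^sub>F n in sequentially. enn2real (?H (1 / real (Suc n))) < e"
      by (rule order_tendstoD(2)[OF lim0 \<open>e > 0\<close>])
    then obtain n where n: "enn2real (?H (1 / real (Suc n))) < e"
      by (meson eventually_sequentially order_refl)
    have "enn2real (?H x) < e" if "x < 1 / real (Suc n)" for x
    proof -
      have "enn2real (?H x) \<le> enn2real (?H (1 / real (Suc n)))"
        using that fin by (intro enn2real_mono unit_step_nconv_mono) auto
      with n show ?thesis by simp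
    qed
    then show "\<forall>\<^sub>F x in at_right 0. enn2real (?H x) < e"
      by (auto simp: eventually_at_right_field intro!: exI[of _ "1 / real (Suc n)"])
  qed
qed

text \<open>With \<open>a k\<close> and \<open>b k\<close> the convolutions of \<open>g^{*(k+1)}\<close> with \<open>1\<close> and with \<open>u\<close>, convolving the renewal equation
  with \<open>g^{*(k+1)}\<close> gives the recursion \<open>a k = \<delta> b k + b (k+1)\<close>.  It telescopes the alternating sum, and it
  squeezes the quotient \<open>\<delta> b n / a n\<close> because \<open>b (n+1)\<close> is at most \<open>H / \<delta>\<close> times \<open>a n\<close>.\<close>

lemma renewal_expansion:
  fixes u :: "real \<Rightarrow> real" and \<delta> :: real
  assumes [measurable]: "pos_ext u \<in> borel_measurable borel"
    and u: "\<And>x. x > 0 \<Longrightarrow> u x \<ge> 0"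
    and "\<delta> > 0"
    and renewal: "\<And>x. x > 0 \<Longrightarrow> ennreal \<delta> * pos_ext u x + nconv (pos_ext g) (pos_ext u) x = 1"
    and pos: "c > 0" "\<And>x. 0 < x \<Longrightarrow> x < c \<Longrightarrow> g x > 0"
  shows "((\<lambda>x. ((\<Sum>k=0..n. (-1) ^ k / \<delta> ^ (k + 1) * heaviside_conv_power g k x) - u x)
               / ((-1) ^ n / \<delta> ^ (n + 2) * heaviside_conv_power g (n + 1) x))
          \<longlongrightarrow> 1) (at_right 0)"
proof -
  let ?G = "pos_ext g" and ?v = "pos_ext u"
  let ?P = "nconv_power_Suc ?G"
  define a where "a k x = enn2real (nconv unit_step (?P k) x)" for k x
  define b where "b k x = enn2real (nconv (?P k) ?v x)" for k x
  define H where "H x = enn2real (nconv unit_step ?G x)" for x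
  have one: "unit_step = (\<lambda>x. ennreal \<delta> * ?v x + nconv ?G ?v x)"
  proof
    fix x show "unit_step x = ennreal \<delta> * ?v x + nconv ?G ?v x"
      using renewal[of x] nconv_eq_0_left_half[of ?G ?v x] by (cases "x > 0") auto
  qed
  have power_shift: "nconv (?P k) (nconv ?G ?v) = nconv (?P (Suc k)) ?v" for k
  proof -
    have "nconv (?P k) (nconv ?G ?v) = nconv ?G (nconv (?P k) ?v)"
      by (rule nconv_left_commute) measurable
    also have "\<dots> = nconv (nconv ?G (?P k)) ?v"
      by (rule nconv_assoc[symmetric]) measurable
    finally show ?thesis by simp
  qed
  have split: "nconv unit_step (?P k) x = ennreal \<delta> * nconv (?P k) ?v x + nconv (?P (Suc k)) ?v x" for k x
  proof -
    have "nconv unit_step (?P k) x = nconv (?P k) unit_step x"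
      by (rule fun_cong[OF nconv_commute]) measurable
    also have "\<dots> = ennreal \<delta> * nconv (?P k) ?v x + nconv (?P k) (nconv ?G ?v) x"
      by (subst one) (simp add: nconv_add_right nconv_cmult_right)
    also have "nconv (?P k) (nconv ?G ?v) = nconv (?P (Suc k)) ?v"
      by (rule power_shift)
    finally show ?thesis .
  qed
  have fin_a: "nconv unit_step (?P k) x < \<infinity>" for k x
    by (rule unit_step_nconv_power_finite)
  have fin_b: "nconv (?P k) ?v x < \<infinity>" for k x
    using fin_a[of k x] \<open>\<delta> > 0\<close> unfolding split by (auto simp: less_top[symmetric] ennreal_mult_eq_top_iff)
  have ab: "a k x = \<delta> * b k x + b (Suc k) x" for k x
    unfolding a_def b_def split using fin_b[of k x] fin_b[of "Suc k" x] \<open>\<delta> > 0\<close>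
    by (simp add: enn2real_plus enn2real_mult ennreal_mult_less_top)
  have u1: "\<delta> * u x + b 0 x = 1" if "x > 0" for x
  proof -
    have "1 = enn2real (ennreal \<delta> * ?v x + nconv ?G ?v x)"
      using renewal[OF that] by simp
    also have "\<dots> = enn2real (ennreal \<delta> * ?v x) + b 0 x"
      using fin_b[of 0 x] that by (simp add: b_def enn2real_plus ennreal_mult_less_top pos_ext_gt_0)
    finally show ?thesis using \<open>\<delta> > 0\<close> that u[OF that]
      by (simp add: enn2real_mult pos_ext_gt_0)
  qed
  have h: "heaviside_conv_power g (Suc k) x = a k x" for k x
    by (simp only: heaviside_conv_power_Suc_eq a_def)
  have remainder: "(\<Sum>k=0..n. (-1) ^ k / \<delta> ^ (k + 1) * heaviside_conv_power g k x) - u x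
      = (-1) ^ n / \<delta> ^ (n + 1) * b n x" if "x > 0" for x
  proof (induction n)
    case 0
    show ?case using u1[OF that] \<open>\<delta> > 0\<close> by (simp add: field_simps)
  next
    case (Suc n)
    have "(\<Sum>k=0..Suc n. (-1) ^ k / \<delta> ^ (k + 1) * heaviside_conv_power g k x) - u x
        = (-1) ^ n / \<delta> ^ (n + 1) * b n x + (-1) ^ Suc n / \<delta> ^ (Suc n + 1) * a n x"
      using Suc h[of n x] by (simp del: heaviside_conv_power.simps)
    also have "\<dots> = (-1) ^ Suc n / \<delta> ^ (Suc n + 1) * b (Suc n) x"
      using \<open>\<delta> > 0\<close> by (simp add: ab field_simps)
    finally show ?case .
  qed
  have v_le: "?v y \<le> ennreal (1 / \<delta>)" for y
  proof (cases "y > 0")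
    case True
    have "0 \<le> b 0 y" by (simp add: b_def)
    with u1[OF True] have "\<delta> * u y \<le> 1" by linarith
    then show ?thesis using True \<open>\<delta> > 0\<close>
      by (auto simp: pos_ext_gt_0 field_simps intro!: ennreal_leI)
  qed auto
  have b_Suc_le: "b (Suc n) x \<le> H x / \<delta> * a n x" for x
  proof -
    have "nconv (?P (Suc n)) ?v x = nconv (?P n) (nconv ?G ?v) x"
      by (simp only: power_shift)
    also have "\<dots> \<le> (ennreal (1 / \<delta>) * nconv unit_step ?G x) * nconv unit_step (?P n) x"
    proof (rule nconv_le_of_bounded)
      fix y assume "0 < y" "y < x"
      have "nconv ?G ?v y \<le> ennreal (1 / \<delta>) * nconv unit_step ?G y"
        by (rule nconv_le_of_bounded) (auto intro: v_le)
      also have "\<dots> \<le> ennreal (1 / \<delta>) * nconv unit_step ?G x"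
        using \<open>y < x\<close> by (intro mult_left_mono unit_step_nconv_mono) auto
      finally show "nconv ?G ?v y \<le> ennreal (1 / \<delta>) * nconv unit_step ?G x" .
    qed (auto simp: nconv_power_Suc_le_0 intro!: nconv_eq_0_left_half)
    finally have "b (Suc n) x \<le> enn2real ((ennreal (1 / \<delta>) * nconv unit_step ?G x) * nconv unit_step (?P n) x)"
      unfolding b_def using fin fin_a by (intro enn2real_mono) (auto simp: ennreal_mult_less_top)
    then show ?thesis using \<open>\<delta> > 0\<close> by (simp add: enn2real_mult H_def a_def)
  qed
  have P_pos: "?P k x > 0" if "0 < x" "x < c" for k x
    using that
  proof (induction k arbitrary: x)
    case (Suc k)
    then show ?case by (auto intro!: nconv_pos[of _ _ c] simp: pos_ext_gt_0 pos)
  qed (simp add: pos_ext_gt_0 pos)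
  have a_pos: "a n x > 0" if "0 < x" "x < c" for x
    unfolding a_def using fin_a[of n x] that
    by (auto simp: enn2real_positive_iff P_pos intro!: nconv_pos[of _ _ c])
  let ?R = "\<lambda>x. ((\<Sum>k=0..n. (-1) ^ k / \<delta> ^ (k + 1) * heaviside_conv_power g k x) - u x)
               / ((-1) ^ n / \<delta> ^ (n + 2) * heaviside_conv_power g (n + 1) x)"
  have R: "?R x = \<delta> * b n x / a n x" if "0 < x" "x < c" for x
    unfolding remainder[OF that(1)] using a_pos[OF that] \<open>\<delta> > 0\<close> h[of n x]
    by (simp add: field_simps del: heaviside_conv_power.simps)
  have near: "\<forall>\<^sub>F x in at_right 0. 0 < x \<and> x < c"
    using \<open>c > 0\<close> by (auto simp: eventually_at_right_field)
  show ?thesis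
  proof (rule tendsto_sandwich)
    show "\<forall>\<^sub>F x in at_right 0. 1 - H x / \<delta> \<le> ?R x"
      using near
    proof eventually_elim
      case (elim x)
      have "(1 - H x / \<delta>) * a n x \<le> \<delta> * b n x"
        using b_Suc_le[of x] ab[of n x] by (simp add: left_diff_distrib)
      then have "1 - H x / \<delta> \<le> \<delta> * b n x / a n x"
        using elim a_pos[of x] by (simp add: pos_le_divide_eq)
      with R[of x] elim show ?case by (simp only:)
    qed
    show "\<forall>\<^sub>F x in at_right 0. ?R x \<le> 1"
      using near
    proof eventually_elim
      case (elim x)
      have "\<delta> * b n x \<le> a n x" using ab[of n x] by (simp add: b_def)
      then have "\<delta> * b n x / a n x \<le> 1"
        using elim a_pos[of x] by simp
      with R[of x] elim show ?case by (simp only:)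
    qed
    have "((\<lambda>x. 1 - H x / \<delta>) \<longlongrightarrow> 1 - 0 / \<delta>) (at_right 0)"
      unfolding H_def by (intro tendsto_intros unit_step_nconv_tendsto_0) (use \<open>\<delta> > 0\<close> in auto)
    then show "((\<lambda>x. 1 - H x / \<delta>) \<longlongrightarrow> 1) (at_right 0)" by simp
  qed auto
qed

end

section \<open>Continuity of convolutions with a decreasing function\<close>

text \<open>Since \<open>G\<close> decreases, lengthening \<open>x\<close> by \<open>h\<close> can only lower the contribution of the old range \<open>(0,x)\<close>; the new
  range contributes at most \<open>C\<close> times the integral of \<open>G\<close> over \<open>(0,h)\<close>.\<close>

lemma nconv_modulus:
  assumes G [measurable]: "G \<in> borel_measurable borel" and w [measurable]: "w \<in> borel_measurable borel"
    and G0: "\<And>x. x \<le> 0 \<Longrightarrow> G x = 0" and w0: "\<And>x. x \<le> 0 \<Longrightarrow> w x = 0"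
    and anti: "\<And>x y. 0 < x \<Longrightarrow> x \<le> y \<Longrightarrow> G y \<le> G x"
    and le: "\<And>x. w x \<le> C" and h: "h \<ge> 0"
  shows "nconv G w (x + h) \<le> C * nconv unit_step G h + nconv G w x"
proof -
  have "nconv G w (x + h) \<le> (\<integral>\<^sup>+y. C * (G (x + h - y) * indicator {x<..} y) + G (x - y) * w y \<partial>lborel)"
    unfolding nconv_def
  proof (rule nn_integral_mono_AE, use AE_lborel_singleton[of x] in eventually_elim)
    fix y assume "y \<noteq> x"
    show "G (x + h - y) * w y \<le> C * (G (x + h - y) * indicator {x<..} y) + G (x - y) * w y"
    proof (cases "y < x")
      case True
      then have "G (x + h - y) * w y \<le> G (x - y) * w y"
        using h by (intro mult_right_mono anti) auto
      then show ?thesis by (simp add: add_increasing)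
    next
      case False
      with \<open>y \<noteq> x\<close> have "G (x + h - y) * w y \<le> C * (G (x + h - y) * indicator {x<..} y)"
        using mult_left_mono[OF le[of y], of "G (x + h - y)"] by (simp add: mult.commute)
      then show ?thesis by (simp add: add_increasing2)
    qed
  qed
  also have "\<dots> = C * (\<integral>\<^sup>+y. G (x + h - y) * indicator {x<..} y \<partial>lborel) + nconv G w x"
    by (simp add: nconv_def nn_integral_add nn_integral_cmult)
  also have "(\<integral>\<^sup>+y. G (x + h - y) * indicator {x<..} y \<partial>lborel)
      = ennreal \<bar>1\<bar> * (\<integral>\<^sup>+y. G (x + h - (x + 1 * y)) * indicator {x<..} (x + 1 * y) \<partial>lborel)"
    by (rule nn_integral_real_affine) auto
  also have "\<dots> = nconv G unit_step h"
    by (simp add: nconv_def indicator_def)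
  also have "nconv G unit_step h = nconv unit_step G h"
    by (rule fun_cong[OF nconv_commute]) auto
  finally show ?thesis .
qed

text \<open>The previous bound controls increments from above for every weight between \<open>0\<close> and \<open>C\<close>.  Applied to \<open>w\<close> and to \<open>C - w\<close> it
  gives both one-sided estimates, hence the modulus of continuity \<open>C H\<close>.\<close>

lemma enn2real_nconv_continuous:
  fixes C :: real
  assumes G [measurable]: "pos_ext g \<in> borel_measurable borel" and w [measurable]: "w \<in> borel_measurable borel"
    and g: "\<And>x. 0 < x \<Longrightarrow> 0 \<le> g x"
    and anti: "\<And>x y. 0 < x \<Longrightarrow> x \<le> y \<Longrightarrow> g y \<le> g x"
    and fin: "\<And>x. nconv unit_step (pos_ext g) x < \<infinity>"
    and w0: "\<And>x. x \<le> 0 \<Longrightarrow> w x = 0" and le: "\<And>x. w x \<le> ennreal C" and C: "C \<ge> 0"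
  shows "continuous_on UNIV (\<lambda>x. enn2real (nconv (pos_ext g) w x))"
proof -
  let ?G = "pos_ext g"
  define H where "H x = enn2real (nconv unit_step ?G x)" for x
  define a where "a x = enn2real (nconv ?G w x)" for x
  have H: "nconv unit_step ?G x = ennreal (H x)" "0 \<le> H x" for x
    using fin[of x] by (auto simp: H_def less_top)
  have G_anti: "?G y \<le> ?G x" if "0 < x" "x \<le> y" for x y
    using that anti[OF that] by (simp add: pos_ext_gt_0 ennreal_leI)
  have bound: "nconv ?G v x \<le> ennreal C * nconv unit_step ?G x"
    if [measurable]: "v \<in> borel_measurable borel" and "\<And>x. x \<le> 0 \<Longrightarrow> v x = 0" "\<And>x. v x \<le> ennreal C" for v x
    by (rule nconv_le_of_bounded) (use that in auto)
  have a: "nconv ?G w x = ennreal (a x)" "0 \<le> a x" for x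
  proof -
    have "nconv ?G w x < \<infinity>"
      using bound[OF w w0 le, of x] fin[of x]
      by (auto simp: ennreal_mult_eq_top_iff less_top[symmetric] top_unique)
    then show "nconv ?G w x = ennreal (a x)" "0 \<le> a x" by (simp_all add: a_def less_top)
  qed
  define w' where "w' y = (ennreal C - w y) * unit_step y" for y
  have w' [measurable]: "w' \<in> borel_measurable borel" unfolding w'_def[abs_def] by measurable
  have w'_props: "x \<le> 0 \<Longrightarrow> w' x = 0" "w' x \<le> ennreal C" for x
    by (auto simp: w'_def indicator_def diff_le_self_ennreal)
  have ww': "w y + w' y = ennreal C * unit_step y" for y
    using le[of y] w0[of y] by (cases "y > 0") (auto simp: w'_def add_diff_inverse_ennreal)
  have sum: "nconv ?G w x + nconv ?G w' x = ennreal (C * H x)" for x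
  proof -
    have "nconv ?G w x + nconv ?G w' x = nconv ?G (\<lambda>y. ennreal C * unit_step y) x"
      by (simp only: ww'[symmetric]) (rule nconv_add_right[symmetric], measurable)
    also have "\<dots> = ennreal C * nconv unit_step ?G x"
      by (simp add: nconv_cmult_right nconv_commute[of ?G unit_step])
    finally show ?thesis using H[of x] C by (simp add: ennreal_mult)
  qed
  have w'_val: "nconv ?G w' x = ennreal (C * H x - a x)" "a x \<le> C * H x" for x
  proof -
    have "ennreal (a x) + nconv ?G w' x = ennreal (C * H x)" using sum[of x] a by simp
    then show "a x \<le> C * H x" "nconv ?G w' x = ennreal (C * H x - a x)"
      using a(2)[of x] H(2)[of x] C
      by (cases "nconv ?G w' x"; auto simp flip: ennreal_plus)+
  qed
  have inc: "a (x + h) \<le> C * H h + a x" if "h \<ge> 0" for x h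
  proof -
    have "ennreal (a (x + h)) \<le> ennreal C * nconv unit_step ?G h + ennreal (a x)"
      unfolding a(1)[symmetric] by (rule nconv_modulus) (use that w0 le G_anti in auto)
    then show ?thesis using H[of h] a(2)[of x] C by (simp add: ennreal_mult[symmetric] flip: ennreal_plus)
  qed
  have inc': "C * H (x + h) - a (x + h) \<le> C * H h + (C * H x - a x)" if "h \<ge> 0" for x h
  proof -
    have "ennreal (C * H (x + h) - a (x + h)) \<le> ennreal C * nconv unit_step ?G h + ennreal (C * H x - a x)"
      unfolding w'_val(1)[symmetric] by (rule nconv_modulus) (use that w'_props G_anti in auto)
    then show ?thesis using H[of h] w'_val(2)[of x] C by (simp add: ennreal_mult[symmetric] flip: ennreal_plus)
  qed
  have H_mono: "H x \<le> H y" if "x \<le> y" for x y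
    unfolding H_def using fin by (intro enn2real_mono unit_step_nconv_mono that) auto
  have dec: "a x \<le> C * H h + a (x + h)" if "h \<ge> 0" for x h
    using inc'[OF that, of x] mult_left_mono[OF H_mono[of x "x + h"] C] that by simp
  have modulus: "\<bar>a y - a x\<bar> \<le> C * H \<bar>y - x\<bar>" for x y
    using inc[of "y - x" x] dec[of "y - x" x] inc[of "x - y" y] dec[of "x - y" y]
    by (cases "x \<le> y") auto
  have H0: "(H \<longlongrightarrow> 0) (at_right 0)"
    unfolding H_def[abs_def] by (rule unit_step_nconv_tendsto_0) (use g fin in auto)
  have "isCont a x" for x
    unfolding isCont_def LIM_def
  proof (intro allI impI)
    fix e :: real assume e: "e > 0"
    have "\<forall>\<^sub>F h in at_right 0. H h < e / (C + 1)"
      using H0 e C by (intro order_tendstoD) auto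
    then obtain d where d: "d > 0" "\<And>h. 0 < h \<Longrightarrow> h < d \<Longrightarrow> H h < e / (C + 1)"
      by (auto simp: eventually_at_right_field)
    show "\<exists>s>0. \<forall>y. y \<noteq> x \<and> dist y x < s \<longrightarrow> dist (a y) (a x) < e"
    proof (intro exI[of _ d] conjI allI impI d(1))
      fix y assume y: "y \<noteq> x \<and> dist y x < d"
      have "\<bar>a y - a x\<bar> \<le> C * H \<bar>y - x\<bar>" by (rule modulus)
      also have "\<dots> \<le> (C + 1) * H \<bar>y - x\<bar>" using H(2) by (intro mult_right_mono) auto
      also have "\<dots> < (C + 1) * (e / (C + 1))"
        using d(2)[of "\<bar>y - x\<bar>"] y C by (intro mult_strict_left_mono) (auto simp: dist_real_def)
      also have "\<dots> = e" using C by simp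
      finally show "dist (a y) (a x) < e" by (simp add: dist_real_def)
    qed
  qed
  then show ?thesis by (simp add: continuous_on_eq_continuous_at a_def[abs_def])
qed

text \<open>The points of \<open>(0,\<infinity>)\<close> where \<open>f\<close> and \<open>g\<close> differ form an open set, which has positive measure unless it is empty.\<close>

lemma continuous_eq_of_AE_eq:
  fixes f g :: "real \<Rightarrow> real"
  assumes f: "continuous_on {0<..} f" and g: "continuous_on {0<..} g"
    and eq: "AE x in lborel. x > 0 \<longrightarrow> f x = g x" and x: "x > 0"
  shows "f x = g x"
proof (rule ccontr)
  assume ne: "f x \<noteq> g x"
  let ?S = "{0<..} \<inter> (\<lambda>x. f x - g x) -` (- {0})"
  have S: "open ?S"
    by (intro continuous_open_preimage continuous_on_diff f g) auto
  have "AE x in lborel. x \<notin> ?S"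
    using eq by eventually_elim auto
  then have "emeasure lborel ?S = 0"
    using S by (subst (asm) AE_iff_measurable[where N = ?S]) auto
  moreover have "x \<in> ?S" using x ne by simp
  then obtain e where "e > 0" "ball x e \<subseteq> ?S"
    by (rule openE[OF S])
  ultimately have "emeasure lborel (ball x e) = 0"
    using emeasure_mono[of "ball x e" ?S lborel] borel_open[OF S] by simp
  then show False using \<open>e > 0\<close> by (simp add: ball_eq_greaterThanLessThan)
qed

section \<open>Laplace transforms\<close>

definition laplace :: "real measure \<Rightarrow> real \<Rightarrow> ennreal" where
  "laplace m l = (\<integral>\<^sup>+x. ennreal (exp (- l * x)) \<partial>m)"

text \<open>Distributions on a bounded interval are determined by their moments because the Taylor polynomials of the
  characteristic function converge.\<close>

lemma real_distribution_eq_of_moments: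
  assumes M: "real_distribution M" "real_distribution N"
    and bnd: "AE x in M. \<bar>x\<bar> \<le> 1" "AE x in N. \<bar>x\<bar> \<le> 1"
    and moments: "\<And>k. integral\<^sup>L M (\<lambda>x. x ^ k) = integral\<^sup>L N (\<lambda>x. x ^ k)"
  shows "M = N"
proof (rule Levy_uniqueness[OF M], rule ext)
  fix t
  have approx: "cmod (char D t - (\<Sum>k\<le>n. (\<i> * t) ^ k / fact k * integral\<^sup>L D (\<lambda>x. x ^ k))) \<le> 2 * \<bar>t\<bar> ^ n / fact n"
    if D: "real_distribution D" and bD: "AE x in D. \<bar>x\<bar> \<le> 1" for D n
  proof -
    interpret real_distribution D by fact
    have pow: "AE x in D. \<bar>x ^ k\<bar> \<le> 1" for k
      using bD by eventually_elim (simp add: power_abs power_le_one)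
    have int: "integrable D (\<lambda>x. x ^ k)" for k
      using pow by (intro integrable_const_bound[where B=1]) auto
    have "expectation (\<lambda>x. \<bar>x\<bar> ^ n) \<le> 1"
      using pow[of n] int[of n] by (intro integral_le_const) (auto simp: power_abs[symmetric])
    then have "2 * \<bar>t\<bar> ^ n / fact n * expectation (\<lambda>x. \<bar>x\<bar> ^ n) \<le> 2 * \<bar>t\<bar> ^ n / fact n * 1"
      by (intro mult_left_mono) auto
    with char_approx1[of n t, OF int] show ?thesis by simp
  qed
  have "cmod (char M t - char N t) \<le> 4 * (\<bar>t\<bar> ^ n / fact n)" for n
  proof -
    let ?S = "\<Sum>k\<le>n. (\<i> * t) ^ k / fact k * integral\<^sup>L N (\<lambda>x. x ^ k)"
    have "cmod (char M t - char N t) \<le> cmod (char M t - ?S) + cmod (char N t - ?S)"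
      using norm_triangle_ineq4[of "char M t - ?S" "char N t - ?S"] by simp
    then show ?thesis
      using approx[OF M(1) bnd(1), of n] approx[OF M(2) bnd(2), of n] unfolding moments by simp
  qed
  moreover have "(\<lambda>n. 4 * (\<bar>t\<bar> ^ n / fact n)) \<longlonglongrightarrow> 4 * 0"
    using summable_LIMSEQ_zero[OF summable_exp[of "\<bar>t\<bar>"]]
    by (intro tendsto_intros) (simp add: field_simps)
  ultimately have "cmod (char M t - char N t) \<le> 4 * 0"
    by (intro LIMSEQ_le_const) auto
  then show "char M t = char N t" by simp
qed

lemma laplace_eq_0_imp_null:
  assumes [measurable_cong]: "sets m = sets borel" and "laplace m l = 0" 
  shows "emeasure m A = 0"
proof -
  have "AE x in m. ennreal (exp (- l * x)) = 0"
    using assms(2) unfolding laplace_def by (subst (asm) nn_integral_0_iff_AE) auto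
  then have "AE x in m. False" by eventually_elim simp
  then have "emeasure m (space m) = 0"
    by (subst (asm) AE_iff_measurable[OF sets.top]) auto
  then show ?thesis
    by (metis emeasure_space le_zero_eq)
qed

text \<open>Under the substitution \<open>y = exp (-x)\<close> the values of the transform at positive integers become the moments of a
  finite measure on \<open>(0,1]\<close>; the weight \<open>exp (-x)\<close> makes it finite and can be undone afterwards.  So the
  transform at integers already determines the measure.\<close>

theorem laplace_unique:
  assumes sets [measurable_cong]: "sets m1 = sets borel" "sets m2 = sets borel"
    and pos: "AE x in m1. 0 \<le> x" "AE x in m2. 0 \<le> x"
    and eq: "\<And>n. laplace m1 (real (Suc n)) = laplace m2 (real (Suc n))"
    and fin: "laplace m1 1 < \<infinity>"
  shows "m1 = m2"
proof (cases "laplace m1 1 = 0")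
  case True
  then show ?thesis using laplace_eq_0_imp_null[of m1 1] laplace_eq_0_imp_null[of m2 1] eq[of 0]
    by (intro measure_eqI) (auto simp: sets)
next
  case False
  define c where "c = enn2real (laplace m1 1)"
  have c: "c > 0" "laplace m1 1 = ennreal c"
    using fin False unfolding c_def by (auto simp: enn2real_positive_iff less_top zero_less_iff_neq_zero)
  define D where "D m = distr (density m (\<lambda>x. ennreal (exp (- x) / c))) borel (\<lambda>x. exp (- x))" for m
  have D_nn: "(\<integral>\<^sup>+y. f y \<partial>D m) = (\<integral>\<^sup>+x. ennreal (exp (- x) / c) * f (exp (- x)) \<partial>m)"
    if [measurable_cong]: "sets m = sets borel" and [measurable]: "f \<in> borel_measurable borel" for m f
    unfolding D_def by (simp add: nn_integral_distr nn_integral_density)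
  have D_moment: "(\<integral>\<^sup>+y. ennreal (y ^ k) \<partial>D m) = laplace m (real (Suc k)) / ennreal c"
    if [measurable_cong]: "sets m = sets borel" for m k
  proof -
    have "exp (- x) / c * exp (- x) ^ k = exp (- (real (Suc k)) * x) / c" for x
      by (simp add: exp_of_nat_mult[symmetric] exp_add[symmetric] algebra_simps)
    then have "(\<integral>\<^sup>+y. ennreal (y ^ k) \<partial>D m) = (\<integral>\<^sup>+x. ennreal (exp (- (real (Suc k)) * x)) / ennreal c \<partial>m)"
      using c by (subst D_nn) (auto simp: that divide_ennreal ennreal_mult[symmetric] simp del: of_nat_Suc intro!: nn_integral_cong)
    also have "\<dots> = laplace m (real (Suc k)) / ennreal c"
      unfolding laplace_def by (intro nn_integral_divide) measurable
    finally show ?thesis .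
  qed
  have D_bnd: "AE y in D m. 0 \<le> y \<and> \<bar>y\<bar> \<le> 1" if [measurable_cong]: "sets m = sets borel" and "AE x in m. 0 \<le> x" for m
    unfolding D_def using that(2) by (subst AE_distr_iff) (auto simp: AE_density)
  have D_distr: "real_distribution (D m)"
    if s[measurable_cong]: "sets m = sets borel" and "laplace m 1 = ennreal c" for m
  proof -
    have "emeasure (D m) UNIV = (\<integral>\<^sup>+y. ennreal (y ^ 0) \<partial>D m)"
      by (simp add: D_def)
    also have "\<dots> = 1"
      using that c by (subst D_moment) (auto simp: divide_ennreal)
    finally have "prob_space (D m)" by (intro prob_spaceI) (simp add: D_def)
    then show ?thesis
      by (simp add: real_distribution_def real_distribution_axioms_def D_def)
  qed
  have m2: "laplace m2 1 = ennreal c" using eq[of 0] c by simp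
  have D_integral: "integral\<^sup>L (D m) (\<lambda>y. y ^ k) = enn2real (laplace m (real (Suc k)) / ennreal c)"
    if [measurable_cong]: "sets m = sets borel" and "AE x in m. 0 \<le> x" for m k
  proof -
    have "integral\<^sup>L (D m) (\<lambda>y. y ^ k) = enn2real (\<integral>\<^sup>+y. ennreal (y ^ k) \<partial>D m)"
      using D_bnd[OF that] by (intro integral_eq_nn_integral) (auto simp: D_def elim!: eventually_mono)
    with D_moment[OF that(1)] show ?thesis by simp
  qed
  have D_eq: "D m1 = D m2"
  proof (rule real_distribution_eq_of_moments)
    show "real_distribution (D m1)" "real_distribution (D m2)"
      using D_distr sets c m2 by auto
    show "AE x in D m1. \<bar>x\<bar> \<le> 1" "AE x in D m2. \<bar>x\<bar> \<le> 1"
      using D_bnd[OF sets(1) pos(1)] D_bnd[OF sets(2) pos(2)] by auto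
  qed (simp only: D_integral sets pos eq)
  have recover: "emeasure m A = (\<integral>\<^sup>+y. ennreal (c / y) * indicator A (- ln y) \<partial>D m)"
    if [measurable_cong]: "sets m = sets borel" and [measurable]: "A \<in> sets borel" for m A
  proof -
    have "ennreal (exp (- x) / c) * (ennreal (c / exp (- x)) * indicator A (- ln (exp (- x)))) = indicator A x" for x
      using c by (auto simp: mult.assoc[symmetric] ennreal_mult[symmetric] indicator_def)
    then show ?thesis by (subst D_nn) (auto simp: that)
  qed
  show ?thesis
    by (rule measure_eqI) (auto simp: sets recover D_eq)
qed

lemma sigma_finite_of_integrable_positive:
  assumes h [measurable]: "h \<in> borel_measurable m" and pos: "\<And>x. x \<in> space m \<Longrightarrow> h x > 0"
    and fin: "(\<integral>\<^sup>+x. ennreal (h x) \<partial>m) < \<infinity>"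
  shows "sigma_finite_measure m"
proof
  let ?A = "\<lambda>n. {x \<in> space m. 1 \<le> ennreal (real (Suc n)) * ennreal (h x)}"
  have "emeasure m (?A n) < \<infinity>" for n
  proof -
    have "emeasure m (?A n) \<le> ennreal (real (Suc n)) * (\<integral>\<^sup>+x. ennreal (h x) * indicator (space m) x \<partial>m)"
      using nn_integral_Markov_inequality[of "\<lambda>x. ennreal (h x)" "space m" m "ennreal (real (Suc n))"] by simp
    also have "(\<integral>\<^sup>+x. ennreal (h x) * indicator (space m) x \<partial>m) = (\<integral>\<^sup>+x. ennreal (h x) \<partial>m)"
      by (intro nn_integral_cong) simp
    finally show ?thesis using fin by (auto simp: ennreal_mult_less_top intro: le_less_trans)
  qed
  moreover have "(\<Union>n. ?A n) = space m"
  proof safe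
    fix x assume x: "x \<in> space m"
    obtain n where n: "inverse (real (Suc n)) < h x" using reals_Archimedean[OF pos[OF x]] by blast
    then have "1 \<le> real (Suc n) * h x" by (simp add: field_simps)
    then have "1 \<le> ennreal (real (Suc n)) * ennreal (h x)"
      using pos[OF x] by (simp add: ennreal_mult[symmetric] del: of_nat_Suc)
    with x show "x \<in> (\<Union>n. ?A n)" by blast
  qed
  ultimately show "\<exists>A. countable A \<and> A \<subseteq> sets m \<and> \<Union> A = space m \<and> (\<forall>a\<in>A. emeasure m a \<noteq> \<infinity>)"
    by (intro exI[of _ "range ?A"]) (auto simp: less_top)
qed

lemma nn_integral_exp_decay:
  assumes "c > 0"
  shows "(\<integral>\<^sup>+x. ennreal (exp (- c * x)) * indicator {0<..} x \<partial>lborel) = ennreal (1 / c)"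
proof -
  interpret E: prob_space "density lborel (exponential_density c)"
    by (rule prob_space_exponential_density[OF assms])
  have "1 = (\<integral>\<^sup>+x. ennreal (exponential_density c x) \<partial>lborel)"
    using E.emeasure_space_1 by (simp add: emeasure_density)
  also have "\<dots> = (\<integral>\<^sup>+x. ennreal c * (ennreal (exp (- c * x)) * indicator {0<..} x) \<partial>lborel)"
    using AE_lborel_singleton[of 0]
    by (intro nn_integral_cong_AE, eventually_elim)
      (use assms in \<open>auto simp: exponential_density_def indicator_def ennreal_mult mult_ac\<close>)
  also have "\<dots> = ennreal c * (\<integral>\<^sup>+x. ennreal (exp (- c * x)) * indicator {0<..} x \<partial>lborel)"
    by (rule nn_integral_cmult) measurable
  finally have "ennreal (1 / c) * 1 = ennreal (1 / c) * ennreal c * (\<integral>\<^sup>+x. ennreal (exp (- c * x)) * indicator {0<..} x \<partial>lborel)"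
    by (simp add: mult.assoc)
  then show ?thesis using assms by (simp add: ennreal_mult[symmetric])
qed

lemma laplace_density:
  assumes [measurable]: "F \<in> borel_measurable borel"
  shows "laplace (density lborel F) l = (\<integral>\<^sup>+x. ennreal (exp (- l * x)) * F x \<partial>lborel)"
  unfolding laplace_def by (subst nn_integral_density) (auto simp: mult.commute)

section \<open>Sum of two measures\<close>

text \<open>The renewal equation will be read off from the Laplace transform of the single measure \<open>\<delta> U + (U * g) dx\<close>.\<close>

definition measure_add :: "'b measure \<Rightarrow> 'b measure \<Rightarrow> 'b measure" where
  "measure_add m1 m2 = measure_of (space m1) (sets m1) (\<lambda>A. emeasure m1 A + emeasure m2 A)"

context
  fixes m1 m2 :: "'b measure"
  assumes sets_eq: "sets m1 = sets m2"
begin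

lemma sets_measure_add [simp, measurable_cong]: "sets (measure_add m1 m2) = sets m1"
  by (simp add: measure_add_def)

lemma emeasure_measure_add:
  assumes "A \<in> sets m1"
  shows "emeasure (measure_add m1 m2) A = emeasure m1 A + emeasure m2 A"
  unfolding measure_add_def
proof (rule emeasure_measure_of_sigma)
  show "countably_additive (sets m1) (\<lambda>A. emeasure m1 A + emeasure m2 A)"
    by (auto simp: countably_additive_def suminf_add[symmetric] suminf_emeasure sets_eq)
qed (use assms in \<open>auto simp: positive_def sets.sigma_algebra_axioms\<close>)

lemma nn_integral_measure_add:
  assumes "f \<in> borel_measurable m1"
  shows "(\<integral>\<^sup>+x. f x \<partial>measure_add m1 m2) = (\<integral>\<^sup>+x. f x \<partial>m1) + (\<integral>\<^sup>+x. f x \<partial>m2)"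
  using assms
proof (induction rule: borel_measurable_induct)
  case (cong f g)
  have "space (measure_add m1 m2) = space m1" "space m2 = space m1"
    by (auto intro!: sets_eq_imp_space_eq simp: sets_eq)
  with cong show ?case
    by (simp cong: nn_integral_cong_simp)
next
  case (set A)
  then show ?case using sets_eq by (simp add: emeasure_measure_add)
next
  case (mult u c)
  then show ?case
    by (simp add: nn_integral_cmult distrib_left measurable_cong_sets[OF sets_eq refl]
        measurable_cong_sets[OF sets_measure_add refl])
next
  case (add u v)
  then show ?case
    by (simp add: nn_integral_add measurable_cong_sets[OF sets_eq refl]
        measurable_cong_sets[OF sets_measure_add refl] ac_simps)
next
  case (seq U)
  then have meas: "U i \<in> borel_measurable m2" "U i \<in> borel_measurable (measure_add m1 m2)" for i
    by (auto simp: measurable_cong_sets[OF sets_eq refl] measurable_cong_sets[OF sets_measure_add refl])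
  have mono: "incseq (\<lambda>i. integral\<^sup>N m (U i))" for m
    using seq by (auto simp: incseq_def le_fun_def intro!: nn_integral_mono)
  have sup: "(\<integral>\<^sup>+x. (SUP i. U i) x \<partial>m) = (SUP i. integral\<^sup>N m (U i))"
    if "\<And>i. U i \<in> borel_measurable m" for m
    using nn_integral_monotone_convergence_SUP[OF \<open>incseq U\<close> that] by (simp add: SUP_apply image_comp)
  show ?case
    unfolding sup[OF meas(2)] sup[OF meas(1)] sup[OF seq(1)] seq
    by (rule ennreal_SUP_add[OF mono mono])
qed

end

section \<open>Laplace functional of a Poisson random measure\<close>

text \<open>The map \<open>z \<mapsto> exp (-z)\<close> with value \<open>0\<close> at \<open>\<infinity>\<close>.  Allowing infinite arguments treats sets of finite and of
  infinite intensity, on which a Poisson random measure is almost surely finite or infinite, alike.\<close>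

definition expneg :: "ennreal \<Rightarrow> ennreal" where
  "expneg z = (if z = \<infinity> then 0 else ennreal (exp (- enn2real z)))"

lemma measurable_expneg [measurable]: "expneg \<in> borel_measurable borel"
  unfolding expneg_def by measurable

lemma expneg_0 [simp]: "expneg 0 = 1"
  by (simp add: expneg_def)

lemma expneg_top [simp]: "expneg \<top> = 0"
  by (simp add: expneg_def)

lemma expneg_ennreal: "r \<ge> 0 \<Longrightarrow> expneg (ennreal r) = ennreal (exp (- r))"
  by (simp add: expneg_def)

lemma expneg_add: "expneg (a + b) = expneg a * expneg b"
  by (cases a; cases b) (auto simp: expneg_ennreal ennreal_mult[symmetric] exp_add[symmetric] simp flip: ennreal_plus)

lemma expneg_sum: "expneg (\<Sum>i\<in>I. f i) = (\<Prod>i\<in>I. expneg (f i))"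
  by (induction I rule: infinite_finite_induct) (auto simp: expneg_add)

lemma expneg_antimono: "a \<le> b \<Longrightarrow> expneg b \<le> expneg a"
  by (cases a; cases b) (auto simp: expneg_ennreal top_unique)

lemma expneg_le_1: "expneg a \<le> 1"
  using expneg_antimono[of 0 a] by simp

lemma tendsto_expneg:
  assumes "(f \<longlongrightarrow> l) F"
  shows "((\<lambda>x. expneg (f x)) \<longlongrightarrow> expneg l) F"
proof (cases l)
  case (real r)
  have "\<forall>\<^sub>F x in F. f x < \<top>"
    using order_tendstoD(2)[OF assms, of \<top>] real by simp
  then have "\<forall>\<^sub>F x in F. ennreal (exp (- enn2real (f x))) = expneg (f x)"
    by eventually_elim (auto simp: expneg_def)
  moreover have "((\<lambda>x. ennreal (exp (- enn2real (f x)))) \<longlongrightarrow> ennreal (exp (- r))) F"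
    by (intro tendsto_intros) (use assms real in auto)
  ultimately show ?thesis
    unfolding real expneg_ennreal[OF \<open>0 \<le> r\<close>] by (rule Lim_transform_eventually[rotated])
next
  case top
  show ?thesis
    unfolding top expneg_top
  proof (rule order_tendstoI)
    fix e :: ennreal assume "0 < e"
    then obtain d where d: "0 < d" "ennreal d < e"
      by (metis dense ennreal_cases ennreal_less_zero_iff less_top_ennreal not_less_iff_gr_or_eq order_less_imp_not_less zero_less_iff_neq_zero top.not_eq_extremum ennreal_0 less_eq_real_def)
    have "\<forall>\<^sub>F x in F. ennreal (max 0 (- ln d)) < f x"
      using order_tendstoD(1)[OF assms] top by simp
    then show "\<forall>\<^sub>F x in F. expneg (f x) < e"
    proof eventually_elim
      case (elim x)
      have "expneg (f x) \<le> expneg (ennreal (max 0 (- ln d)))"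
        using elim by (intro expneg_antimono) simp
      also have "\<dots> \<le> ennreal (exp (- (- ln d)))"
        by (subst expneg_ennreal) (auto intro!: ennreal_leI)
      also have "\<dots> < e" using d by simp
      finally show ?case .
    qed
  qed simp
qed

lemma nn_integral_finite_range:
  fixes h :: "ennreal \<Rightarrow> ennreal" and n :: nat
  assumes e: "bij_betw e {..<n} (f ` space \<mu>)"
    and B: "\<And>i. i < n \<Longrightarrow> f -` {e i} \<inter> space \<mu> \<in> sets \<mu>"
    and D: "sets D = sets \<mu>"
  shows "(\<integral>\<^sup>+x. h (f x) \<partial>D) = (\<Sum>i<n. h (e i) * emeasure D (f -` {e i} \<inter> space \<mu>))"
proof -
  have space: "space D = space \<mu>" by (rule sets_eq_imp_space_eq[OF D])
  have "(\<integral>\<^sup>+x. h (f x) \<partial>D) = (\<integral>\<^sup>+x. (\<Sum>i<n. h (e i) * indicator (f -` {e i} \<inter> space \<mu>) x) \<partial>D)"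
  proof (rule nn_integral_cong)
    fix x assume "x \<in> space D"
    then have x: "x \<in> space \<mu>" by (simp add: space)
    then obtain j where j: "j < n" "f x = e j"
      using e by (auto simp: bij_betw_def)
    have inj: "e i = e j \<longleftrightarrow> i = j" if "i < n" for i
      using e j that by (auto simp: bij_betw_def inj_on_def)
    have "h (e i) * indicator (f -` {e i} \<inter> space \<mu>) x = (if i = j then h (e j) else 0)" if "i < n" for i
      using x j(2) inj[OF that] by (cases "i = j") (auto simp: indicator_def)
    then have "(\<Sum>i<n. h (e i) * indicator (f -` {e i} \<inter> space \<mu>) x) = (\<Sum>i<n. if i = j then h (e j) else 0)"
      by (intro sum.cong) auto
    also have "\<dots> = h (f x)"
      using j by (subst sum.delta) auto
    finally show "h (f x) = (\<Sum>i<n. h (e i) * indicator (f -` {e i} \<inter> space \<mu>) x)" ..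
  qed
  also have "\<dots> = (\<Sum>i<n. \<integral>\<^sup>+x. h (e i) * indicator (f -` {e i} \<inter> space \<mu>) x \<partial>D)"
    using B D by (intro nn_integral_sum) auto
  also have "\<dots> = (\<Sum>i<n. h (e i) * emeasure D (f -` {e i} \<inter> space \<mu>))"
    using B D by (intro sum.cong refl nn_integral_cmult_indicator) auto
  finally show ?thesis .
qed

context
  fixes M :: "'a measure" and \<mu> :: "'b measure" and N :: "'a \<Rightarrow> 'b measure"
  assumes M: "prob_space M" and prm: "poisson_random_measure M \<mu> N"
begin

interpretation prob_space M by (rule M)

lemma prm_sets: "\<omega> \<in> space M \<Longrightarrow> sets (N \<omega>) = sets \<mu>"
  using prm by (simp add: poisson_random_measure_def)

lemma prm_measurable: "B \<in> sets \<mu> \<Longrightarrow> (\<lambda>\<omega>. emeasure (N \<omega>) B) \<in> borel_measurable M"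
  using prm by (simp add: poisson_random_measure_def)

text \<open>For finite intensity this is the generating function of the Poisson distribution.  For infinite intensity both sides are
  \<open>0\<close>, unless \<open>c = 0\<close>.\<close>

lemma prm_laplace_set:
  assumes B: "B \<in> sets \<mu>" and c: "c < \<infinity>"
  shows "(\<integral>\<^sup>+\<omega>. expneg (c * emeasure (N \<omega>) B) \<partial>M) = expneg ((1 - expneg c) * emeasure \<mu> B)"
proof (cases "emeasure \<mu> B = \<infinity>")
  case True
  then have inf: "AE \<omega> in M. emeasure (N \<omega>) B = \<infinity>"
    using prm B by (simp add: poisson_random_measure_def)
  have "(\<integral>\<^sup>+\<omega>. expneg (c * emeasure (N \<omega>) B) \<partial>M) = (\<integral>\<^sup>+\<omega>. expneg (c * \<infinity>) \<partial>M)"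
    by (intro nn_integral_cong_AE) (use inf in auto)
  also have "\<dots> = expneg (c * \<infinity>)" by (simp add: emeasure_space_1)
  also have "\<dots> = expneg ((1 - expneg c) * emeasure \<mu> B)"
  proof (cases "c = 0")
    case False
    with c obtain r where "c = ennreal r" "r > 0"
      by (cases c) (auto simp: less_le)
    then have "1 - expneg c = ennreal (1 - exp (- r))"
      by (simp add: expneg_ennreal ennreal_minus flip: ennreal_1)
    with \<open>r > 0\<close> have "1 - expneg c \<noteq> 0" by simp
    with True False show ?thesis by (simp add: ennreal_mult_top ennreal_top_mult)
  qed simp
  finally show ?thesis .
next
  case False
  note [measurable] = prm_measurable[OF B]
  define m where "m = measure \<mu> B"
  have m: "emeasure \<mu> B = ennreal m" "m \<ge> 0"
    using False by (auto simp: m_def emeasure_eq_ennreal_measure)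
  obtain r where r: "c = ennreal r" "r \<ge> 0" using c by (cases c) auto
  define E where "E k = {\<omega>\<in>space M. emeasure (N \<omega>) B = of_nat k}" for k :: nat
  have E [measurable]: "E k \<in> sets M" for k unfolding E_def by measurable
  have disj: "disjoint_family E"
    by (auto simp: disjoint_family_on_def E_def)
  have pE: "emeasure M (E k) = ennreal (exp (- m) * m ^ k / fact k)" for k
    using prm B False unfolding emeasure_eq_measure poisson_random_measure_def E_def m_def
    by (simp add: less_top)
  have series: "(\<lambda>k. exp (- m) * (exp (- s) * m) ^ k / fact k) sums (exp (- m) * exp (exp (- s) * m))" for s
    using sums_mult[OF exp_converges[of "exp (- s) * m"], of "exp (- m)"] by (simp add: field_simps)
  have "emeasure M (\<Union>k. E k) = (\<Sum>k. emeasure M (E k))"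
    using disj by (intro suminf_emeasure[symmetric]) auto
  also have "\<dots> = ennreal (exp (- m) * exp (exp (- 0) * m))"
    unfolding pE using series[of 0] m by (intro suminf_ennreal_eq) auto
  also have "\<dots> = 1" by (simp add: exp_minus_inverse mult.commute flip: exp_add)
  \<comment> \<open>the Poisson weights sum to \<open>1\<close>, so the count is almost surely a natural number\<close>
  finally have "AE \<omega> in M. \<omega> \<in> (\<Union>k. E k)"
    by (intro AE_in_set_eq_1[THEN iffD2]) (auto simp: measure_def)
  then have "(\<integral>\<^sup>+\<omega>. expneg (c * emeasure (N \<omega>) B) \<partial>M)
      = (\<integral>\<^sup>+\<omega>. (\<Sum>k. expneg (c * of_nat k) * indicator (E k) \<omega>) \<partial>M)"
  proof (intro nn_integral_cong_AE, eventually_elim)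
    case (elim \<omega>)
    then obtain k where k: "\<omega> \<in> E k" by auto
    then show ?case by (simp add: suminf_cmult_indicator[OF disj k]) (simp add: E_def)
  qed
  also have "\<dots> = (\<Sum>k. expneg (c * of_nat k) * emeasure M (E k))"
    by (subst nn_integral_suminf) (auto simp: nn_integral_cmult_indicator)
  also have "\<dots> = (\<Sum>k. ennreal (exp (- m) * (exp (- r) * m) ^ k / fact k))"
  proof (intro suminf_cong)
    fix k
    have "expneg (c * of_nat k) = ennreal (exp (- r) ^ k)"
      using r by (simp add: ennreal_of_nat_eq_real_of_nat expneg_ennreal exp_of_nat2_mult[symmetric] flip: ennreal_mult)
    then show "expneg (c * of_nat k) * emeasure M (E k) = ennreal (exp (- m) * (exp (- r) * m) ^ k / fact k)"
      using m by (simp add: pE power_mult_distrib mult_ac flip: ennreal_mult)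
  qed
  also have "\<dots> = ennreal (exp (- m) * exp (exp (- r) * m))"
    using series[of r] m by (intro suminf_ennreal_eq) auto
  also have "\<dots> = ennreal (exp (- ((1 - exp (- r)) * m)))"
    by (simp add: algebra_simps flip: exp_add)
  also have "\<dots> = expneg (ennreal (1 - exp (- r)) * emeasure \<mu> B)"
    using r m by (subst expneg_ennreal[symmetric]) (auto simp: ennreal_mult)
  also have "ennreal (1 - exp (- r)) = 1 - expneg c"
    using r by (simp add: expneg_ennreal ennreal_minus flip: ennreal_1)
  finally show ?thesis .
qed

lemma prm_laplace_simple:
  assumes f: "simple_function \<mu> f" and fin: "\<And>x. f x < \<top>"
  shows "(\<lambda>\<omega>. \<integral>\<^sup>+x. f x \<partial>N \<omega>) \<in> borel_measurable M"
    and "(\<integral>\<^sup>+\<omega>. expneg (\<integral>\<^sup>+x. f x \<partial>N \<omega>) \<partial>M) = expneg (\<integral>\<^sup>+x. (1 - expneg (f x)) \<partial>\<mu>)"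
proof -
  obtain e where e: "bij_betw e {..<card (f ` space \<mu>)} (f ` space \<mu>)"
    using ex_bij_betw_nat_finite[OF simple_functionD(1)[OF f]] by (auto simp: atLeast0LessThan)
  define n where "n = card (f ` space \<mu>)"
  define B where "B i = f -` {e i} \<inter> space \<mu>" for i
  have e': "bij_betw e {..<n} (f ` space \<mu>)" using e by (simp add: n_def)
  have B: "B i \<in> sets \<mu>" for i
    unfolding B_def by (rule simple_functionD(2)[OF f])
  have disj: "disjoint_family_on B {..<n}"
    using e' by (auto simp: disjoint_family_on_def B_def bij_betw_def inj_on_def)
  have int: "(\<integral>\<^sup>+x. h (f x) \<partial>D) = (\<Sum>i<n. h (e i) * emeasure D (B i))" if "sets D = sets \<mu>" for h :: "ennreal \<Rightarrow> ennreal" and D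
    unfolding B_def by (intro nn_integral_finite_range[OF e' _ that] simple_functionD(2)[OF f])
  have N_int: "(\<integral>\<^sup>+x. f x \<partial>N \<omega>) = (\<Sum>i<n. e i * emeasure (N \<omega>) (B i))" if "\<omega> \<in> space M" for \<omega>
    using int[OF prm_sets[OF that], of "\<lambda>y. y"] .
  note [measurable] = prm_measurable[OF B]
  have "(\<lambda>\<omega>. \<Sum>i<n. e i * emeasure (N \<omega>) (B i)) \<in> borel_measurable M" by measurable
  then show "(\<lambda>\<omega>. \<integral>\<^sup>+x. f x \<partial>N \<omega>) \<in> borel_measurable M"
    by (subst measurable_cong[OF N_int])
  have e_fin: "e i < \<infinity>" if "i < n" for i
  proof -
    have "e i \<in> f ` space \<mu>" using e' that by (auto simp: bij_betw_def)
    then show ?thesis using fin by auto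
  qed
  have "indep_vars (\<lambda>_. borel) (\<lambda>i \<omega>. emeasure (N \<omega>) (B i)) {..<n}"
    using prm B disj unfolding poisson_random_measure_def by blast
  then have indep: "indep_vars (\<lambda>_. borel) (\<lambda>i \<omega>. expneg (e i * emeasure (N \<omega>) (B i))) {..<n}"
    by (rule indep_vars_compose2) measurable
  have "(\<integral>\<^sup>+\<omega>. expneg (\<integral>\<^sup>+x. f x \<partial>N \<omega>) \<partial>M) = (\<integral>\<^sup>+\<omega>. (\<Prod>i<n. expneg (e i * emeasure (N \<omega>) (B i))) \<partial>M)"
    by (intro nn_integral_cong) (simp add: N_int expneg_sum)
  also have "\<dots> = (\<Prod>i<n. \<integral>\<^sup>+\<omega>. expneg (e i * emeasure (N \<omega>) (B i)) \<partial>M)"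
    by (intro indep_vars_nn_integral indep) auto
  also have "\<dots> = (\<Prod>i<n. expneg ((1 - expneg (e i)) * emeasure \<mu> (B i)))"
    using e_fin by (intro prod.cong refl prm_laplace_set B) auto
  also have "\<dots> = expneg (\<integral>\<^sup>+x. (1 - expneg (f x)) \<partial>\<mu>)"
    by (simp add: int[OF refl, of "\<lambda>y. 1 - expneg y"] expneg_sum)
  finally show "(\<integral>\<^sup>+\<omega>. expneg (\<integral>\<^sup>+x. f x \<partial>N \<omega>) \<partial>M) = expneg (\<integral>\<^sup>+x. (1 - expneg (f x)) \<partial>\<mu>)" .
qed

text \<open>For simple functions the level sets are disjoint, so the counts on them are independent and the transforms multiply.
  The general case follows by approximation from below: the integrals against the random measure increase, hence
  their images under \<open>expneg\<close> decrease and are dominated by \<open>1\<close>.\<close>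

theorem
  assumes f [measurable]: "f \<in> borel_measurable \<mu>"
  shows prm_integral_measurable: "(\<lambda>\<omega>. \<integral>\<^sup>+x. f x \<partial>N \<omega>) \<in> borel_measurable M"
    and prm_laplace_functional: "(\<integral>\<^sup>+\<omega>. expneg (\<integral>\<^sup>+x. f x \<partial>N \<omega>) \<partial>M) = expneg (\<integral>\<^sup>+x. (1 - expneg (f x)) \<partial>\<mu>)"
proof -
  obtain F where F: "\<And>i. simple_function \<mu> (F i)" "incseq F" "\<And>i x. F i x < \<top>"
    and sup: "\<And>x. (SUP i. F i x) = f x"
    using borel_measurable_implies_simple_function_sequence'[OF f] by blast
  have F_meas [measurable]: "F i \<in> borel_measurable \<mu>" for i
    using F(1) by (rule borel_measurable_simple_function)
  have F_lim: "(\<lambda>i. F i x) \<longlonglongrightarrow> f x" for x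
    using LIMSEQ_SUP[of "\<lambda>i. F i x"] F(2) by (simp add: sup mono_def le_fun_def)
  have F_N: "F i \<in> borel_measurable (N \<omega>)" if "\<omega> \<in> space M" for i \<omega>
    by (subst measurable_cong_sets[OF prm_sets[OF that] refl]) (rule F_meas)
  have N_lim: "(\<lambda>i. \<integral>\<^sup>+x. F i x \<partial>N \<omega>) \<longlonglongrightarrow> (\<integral>\<^sup>+x. f x \<partial>N \<omega>)" if "\<omega> \<in> space M" for \<omega>
    using F(2) F_lim F_N[OF that] by (intro nn_integral_LIMSEQ) auto
  have N_F [measurable]: "(\<lambda>\<omega>. \<integral>\<^sup>+x. F i x \<partial>N \<omega>) \<in> borel_measurable M" for i
    by (rule prm_laplace_simple) (use F in auto)
  show N_f: "(\<lambda>\<omega>. \<integral>\<^sup>+x. f x \<partial>N \<omega>) \<in> borel_measurable M"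
  proof (subst measurable_cong)
    show "(\<integral>\<^sup>+x. f x \<partial>N \<omega>) = (SUP i. \<integral>\<^sup>+x. F i x \<partial>N \<omega>)" if "\<omega> \<in> space M" for \<omega>
      using F(2) F_N[OF that] by (simp add: sup[symmetric] nn_integral_monotone_convergence_SUP)
  qed measurable
  have "(\<lambda>i. \<integral>\<^sup>+\<omega>. expneg (\<integral>\<^sup>+x. F i x \<partial>N \<omega>) \<partial>M) \<longlonglongrightarrow> (\<integral>\<^sup>+\<omega>. expneg (\<integral>\<^sup>+x. f x \<partial>N \<omega>) \<partial>M)"
  proof (rule nn_integral_dominated_convergence[where w="\<lambda>_. 1"])
    show "(\<lambda>\<omega>. expneg (\<integral>\<^sup>+x. f x \<partial>N \<omega>)) \<in> borel_measurable M"
      using N_f by measurable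
  qed (auto simp: emeasure_space_1 expneg_le_1 intro!: tendsto_expneg N_lim AE_I2)
  moreover have "(\<lambda>i. \<integral>\<^sup>+\<omega>. expneg (\<integral>\<^sup>+x. F i x \<partial>N \<omega>) \<partial>M) \<longlonglongrightarrow> expneg (\<integral>\<^sup>+x. (1 - expneg (f x)) \<partial>\<mu>)"
  proof -
    have "(\<lambda>i. \<integral>\<^sup>+x. (1 - expneg (F i x)) \<partial>\<mu>) \<longlonglongrightarrow> (\<integral>\<^sup>+x. (1 - expneg (f x)) \<partial>\<mu>)"
    proof (rule nn_integral_LIMSEQ)
      show "incseq (\<lambda>i x. 1 - expneg (F i x))"
        using F(2) by (auto simp: incseq_def le_fun_def intro!: ennreal_minus_mono expneg_antimono)
      show "(\<lambda>i. 1 - expneg (F i x)) \<longlonglongrightarrow> 1 - expneg (f x)" for x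
        using le_less_trans[OF expneg_le_1 ennreal_one_less_top, of "f x"]
        by (intro tendsto_diff_ennreal tendsto_const tendsto_expneg F_lim) auto
    qed measurable
    then show ?thesis
      using prm_laplace_simple(2)[OF F(1,3)] by (simp add: tendsto_expneg)
  qed
  ultimately show "(\<integral>\<^sup>+\<omega>. expneg (\<integral>\<^sup>+x. f x \<partial>N \<omega>) \<partial>M) = expneg (\<integral>\<^sup>+x. (1 - expneg (f x)) \<partial>\<mu>)"
    by (rule LIMSEQ_unique)
qed

end

section \<open>Tail of the Levy measure\<close>

context
  fixes \<nu> :: "real measure"
  assumes levy: "subordinator_levy_measure \<nu>"
begin

lemma levy_sets [measurable_cong]: "sets \<nu> = sets borel"
  using levy by (simp add: subordinator_levy_measure_def)

lemma levy_AE_pos: "AE x in \<nu>. x > 0"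
proof -
  have "AE x in \<nu>. x \<notin> {..0}"
    using levy by (intro AE_not_in) (auto simp: subordinator_levy_measure_def null_sets_def)
  then show ?thesis by eventually_elim auto
qed

lemma levy_sigma_finite: "sigma_finite_measure \<nu>"
proof (rule sigma_finite_of_integrable_positive)
  have "(\<integral>\<^sup>+x. ennreal (if x > 0 then min 1 x else 1) \<partial>\<nu>) = (\<integral>\<^sup>+x. ennreal (min 1 x) \<partial>\<nu>)"
    using levy_AE_pos by (intro nn_integral_cong_AE) (auto elim!: eventually_mono)
  then show "(\<integral>\<^sup>+x. ennreal (if x > 0 then min 1 x else 1) \<partial>\<nu>) < \<infinity>"
    using levy by (simp add: subordinator_levy_measure_def)
qed auto

lemma levy_tail_finite: "x > 0 \<Longrightarrow> emeasure \<nu> {x..} < \<infinity>"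
proof -
  assume x: "x > 0"
  have "ennreal (min 1 x) * emeasure \<nu> {x..} = (\<integral>\<^sup>+y. ennreal (min 1 x) * indicator {x..} y \<partial>\<nu>)"
    by (simp add: nn_integral_cmult_indicator levy_sets)
  also have "\<dots> \<le> (\<integral>\<^sup>+y. ennreal (min 1 y) \<partial>\<nu>)"
    by (intro nn_integral_mono) (auto simp: indicator_def intro!: ennreal_leI)
  also have "\<dots> < \<infinity>" using levy by (simp add: subordinator_levy_measure_def)
  finally show ?thesis using x by (auto simp: ennreal_mult_less_top)
qed

lemma emeasure_levy_tail: "x > 0 \<Longrightarrow> emeasure \<nu> {x..} = ennreal (levy_tail \<nu> x)"
  using levy_tail_finite by (simp add: levy_tail_def emeasure_eq_ennreal_measure less_top)

lemma levy_tail_nonneg: "levy_tail \<nu> x \<ge> 0"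
  by (simp add: levy_tail_def)

lemma levy_tail_antimono: "0 < x \<Longrightarrow> x \<le> y \<Longrightarrow> levy_tail \<nu> y \<le> levy_tail \<nu> x"
  using emeasure_mono[of "{y..}" "{x..}" \<nu>] levy_tail_nonneg
  by (auto simp: emeasure_levy_tail levy_sets)

lemma pos_ext_levy_tail:
  "pos_ext (levy_tail \<nu>) y = (\<integral>\<^sup>+z. indicator {0<..z} y \<partial>\<nu>)"
proof (cases "y > 0")
  case True
  have "(\<integral>\<^sup>+z. indicator {0<..z} y \<partial>\<nu>) = (\<integral>\<^sup>+z. indicator {y..} z \<partial>\<nu>)"
    using True by (intro nn_integral_cong) (auto simp: indicator_def)
  then show ?thesis using True by (simp add: pos_ext_gt_0 emeasure_levy_tail levy_sets)
qed simp

lemma measurable_indicator_ray [measurable]: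
  "(\<lambda>p :: real \<times> real. indicator {0<..snd p} (fst p) :: ennreal) \<in> borel_measurable (borel \<Otimes>\<^sub>M borel)"
  "(\<lambda>z. indicator {0<..z} y :: ennreal) \<in> borel_measurable borel" for y :: real
  unfolding indicator_def greaterThanAtMost_iff by measurable

lemma measurable_pos_ext_levy_tail [measurable]:
  "pos_ext (levy_tail \<nu>) \<in> borel_measurable borel"
proof -
  interpret sigma_finite_measure \<nu> by (rule levy_sigma_finite)
  have "(\<lambda>y. \<integral>\<^sup>+z. indicator {0<..z} y \<partial>\<nu>) \<in> borel_measurable borel" by measurable
  then show ?thesis by (simp add: pos_ext_levy_tail[abs_def])
qed

text \<open>Integration by parts in the form of Tonelli; it carries integrals from the tail to \<open>\<nu>\<close>.\<close>

lemma nn_integral_levy_tail: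
  assumes [measurable]: "h \<in> borel_measurable borel"
  shows "(\<integral>\<^sup>+y. h y * pos_ext (levy_tail \<nu>) y \<partial>lborel)
       = (\<integral>\<^sup>+z. (\<integral>\<^sup>+y. h y * indicator {0<..z} y \<partial>lborel) \<partial>\<nu>)"
proof -
  interpret sigma_finite_measure \<nu> by (rule levy_sigma_finite)
  interpret P: pair_sigma_finite lborel \<nu> ..
  have "(\<integral>\<^sup>+y. h y * pos_ext (levy_tail \<nu>) y \<partial>lborel) = (\<integral>\<^sup>+y. (\<integral>\<^sup>+z. h y * indicator {0<..z} y \<partial>\<nu>) \<partial>lborel)"
    unfolding pos_ext_levy_tail by (intro nn_integral_cong nn_integral_cmult[symmetric]) measurable
  also have "\<dots> = (\<integral>\<^sup>+z. (\<integral>\<^sup>+y. h y * indicator {0<..z} y \<partial>lborel) \<partial>\<nu>)"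
    by (rule P.Fubini'[symmetric]) measurable
  finally show ?thesis .
qed

lemma levy_tail_locally_integrable: "nconv unit_step (pos_ext (levy_tail \<nu>)) x < \<infinity>"
proof -
  have "nconv unit_step (pos_ext (levy_tail \<nu>)) x
      = (\<integral>\<^sup>+z. (\<integral>\<^sup>+y. indicator {..<x} y * indicator {0<..z} y \<partial>lborel) \<partial>\<nu>)"
    unfolding unit_step_nconv by (subst nn_integral_levy_tail[symmetric]) (auto simp: mult.commute)
  also have "\<dots> \<le> (\<integral>\<^sup>+z. ennreal (max 1 x) * ennreal (min 1 z) \<partial>\<nu>)"
  proof (rule nn_integral_mono_AE, use levy_AE_pos in eventually_elim)
    fix z :: real assume z: "z > 0"
    have "(\<integral>\<^sup>+y. indicator {..<x} y * indicator {0<..z} y \<partial>lborel) \<le> (\<integral>\<^sup>+y. indicator {0..min (max 1 x) z} y \<partial>lborel)"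
      by (intro nn_integral_mono) (auto simp: indicator_def)
    also have "\<dots> = ennreal (min (max 1 x) z)" using z by simp
    also have "\<dots> \<le> ennreal (max 1 x) * ennreal (min 1 z)"
    proof -
      have "min (max 1 x) z \<le> max 1 x * min 1 z"
        using z mult_right_mono[of 1 "max 1 x" z] by (cases "z \<le> 1") auto
      then show ?thesis using z by (simp add: ennreal_mult[symmetric] ennreal_leI)
    qed
    finally show "(\<integral>\<^sup>+y. indicator {..<x} y * indicator {0<..z} y \<partial>lborel) \<le> ennreal (max 1 x) * ennreal (min 1 z)" .
  qed
  also have "\<dots> = ennreal (max 1 x) * (\<integral>\<^sup>+z. ennreal (min 1 z) \<partial>\<nu>)"
    by (rule nn_integral_cmult) measurable
  also have "\<dots> < \<infinity>" using levy by (simp add: subordinator_levy_measure_def ennreal_mult_less_top)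
  finally show ?thesis .
qed

text \<open>Since \<open>1 - exp (-l z)\<close> is the integral of \<open>l exp (-l y)\<close> over \<open>(0,z]\<close>, the jump part of the Laplace exponent is \<open>l\<close>
  times the transform of the tail.\<close>

lemma laplace_levy_tail:
  assumes "l > 0"
  shows "(\<integral>\<^sup>+x. (1 - expneg (ennreal (l * x))) \<partial>\<nu>)
       = ennreal l * laplace (density lborel (pos_ext (levy_tail \<nu>))) l"
    and "laplace (density lborel (pos_ext (levy_tail \<nu>))) l < \<infinity>"
proof -
  have inner: "(\<integral>\<^sup>+y. ennreal (l * exp (- l * y)) * indicator {0<..z} y \<partial>lborel) = ennreal (1 - exp (- l * z))"
    if "z > 0" for z
  proof -
    have "(\<integral>\<^sup>+y. ennreal (l * exp (- l * y)) * indicator {0<..z} y \<partial>lborel)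
        = (\<integral>\<^sup>+y. ennreal (l * exp (- l * y)) * indicator {0..z} y \<partial>lborel)"
      using AE_lborel_singleton[of 0]
      by (intro nn_integral_cong_AE, eventually_elim) (auto simp: indicator_def)
    also have "\<dots> = ennreal (- exp (- l * z) - (- exp (- l * 0)))"
      using that assms by (intro nn_integral_FTC_Icc) (auto intro!: derivative_eq_intros)
    finally show ?thesis by simp
  qed
  have minus: "1 - expneg (ennreal (l * x)) = ennreal (1 - exp (- l * x))" if "x > 0" for x
    using that assms by (simp add: expneg_ennreal ennreal_minus flip: ennreal_1)
  have "(\<integral>\<^sup>+x. (1 - expneg (ennreal (l * x))) \<partial>\<nu>)
      = (\<integral>\<^sup>+z. (\<integral>\<^sup>+y. ennreal (l * exp (- l * y)) * indicator {0<..z} y \<partial>lborel) \<partial>\<nu>)"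
    using levy_AE_pos by (intro nn_integral_cong_AE, eventually_elim) (simp only: inner minus)
  also have "\<dots> = (\<integral>\<^sup>+y. ennreal (l * exp (- l * y)) * pos_ext (levy_tail \<nu>) y \<partial>lborel)"
    by (rule nn_integral_levy_tail[symmetric]) measurable
  also have "\<dots> = (\<integral>\<^sup>+y. ennreal l * (ennreal (exp (- l * y)) * pos_ext (levy_tail \<nu>) y) \<partial>lborel)"
    using assms by (intro nn_integral_cong) (simp add: ennreal_mult mult.assoc)
  also have "\<dots> = ennreal l * laplace (density lborel (pos_ext (levy_tail \<nu>))) l"
    by (subst nn_integral_cmult) (auto simp: laplace_density)
  finally show eq: "(\<integral>\<^sup>+x. (1 - expneg (ennreal (l * x))) \<partial>\<nu>)
       = ennreal l * laplace (density lborel (pos_ext (levy_tail \<nu>))) l" .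
  have "(\<integral>\<^sup>+x. (1 - expneg (ennreal (l * x))) \<partial>\<nu>) \<le> (\<integral>\<^sup>+x. ennreal (max 1 l) * ennreal (min 1 x) \<partial>\<nu>)"
  proof (rule nn_integral_mono_AE, use levy_AE_pos in eventually_elim)
    fix x :: real assume x: "x > 0"
    have "1 - exp (- l * x) \<le> min 1 (l * x)"
      using exp_ge_add_one_self[of "- l * x"] by simp
    also have "\<dots> \<le> max 1 l * min 1 x"
    proof (cases "x \<le> 1")
      case True
      then show ?thesis using x mult_right_mono[of l "max 1 l" x] by (simp add: min_le_iff_disj)
    qed (simp add: min_le_iff_disj)
    finally show "1 - expneg (ennreal (l * x)) \<le> ennreal (max 1 l) * ennreal (min 1 x)"
      using x by (simp add: minus ennreal_mult[symmetric] ennreal_leI)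
  qed
  also have "\<dots> = ennreal (max 1 l) * (\<integral>\<^sup>+z. ennreal (min 1 z) \<partial>\<nu>)"
    by (rule nn_integral_cmult) measurable
  also have "\<dots> < \<infinity>" using levy by (simp add: subordinator_levy_measure_def ennreal_mult_less_top)
  finally show "laplace (density lborel (pos_ext (levy_tail \<nu>))) l < \<infinity>"
    using assms unfolding eq by (auto simp: ennreal_mult_less_top)
qed

end

section \<open>Laplace transforms of a subordinator and of its potential measures\<close>

lemma path_jump_nonneg:
  assumes x: "cadlag x" "mono_on {0..} x" and s: "s > 0"
  shows "path_jump x s \<ge> 0"
proof -
  obtain l where l: "(x \<longlongrightarrow> l) (at_left s)"
    using x(1) s by (auto simp: cadlag_def)
  have "\<forall>\<^sub>F r in at_left s. x r \<le> x s"
    using eventually_at_left_real[OF s] 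
  proof eventually_elim
    case (elim r)
    then show ?case using s by (intro mono_onD[OF x(2)]) auto
  qed
  then have "l \<le> x s"
    by (intro tendsto_upperbound[OF l]) auto
  moreover have "Lim (at_left s) x = l"
    using l by (intro tendsto_Lim) auto
  ultimately show ?thesis by (simp add: path_jump_def)
qed

text \<open>Along a non-decreasing path all jumps are non-negative, so their sum is an integral against the counting
  measure on the jump times.\<close>

lemma nn_integral_jump_measure:
  assumes x: "cadlag x" "mono_on {0..} x"
    and sum: "(path_jump x has_sum J) {0<..t}" and l: "l \<ge> 0"
  shows "(\<integral>\<^sup>+p. ennreal (l * snd p) * indicator {0<..t} (fst p) \<partial>jump_measure x) = ennreal (l * J)"
proof -
  let ?S = "{s. 0 < s \<and> path_jump x s \<noteq> 0}" and ?g = "\<lambda>s. l * path_jump x s"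
  have [measurable]: "(\<lambda>p :: real \<times> real. ennreal (l * snd p) * indicator {0<..t} (fst p)) \<in> borel_measurable (borel \<Otimes>\<^sub>M borel)"
    by measurable
  have "(\<integral>\<^sup>+p. ennreal (l * snd p) * indicator {0<..t} (fst p) \<partial>jump_measure x)
      = (\<integral>\<^sup>+s. ennreal (?g s) * indicator {0<..t} s \<partial>count_space ?S)"
    unfolding jump_measure_def by (subst nn_integral_distr) (auto simp: space_pair_measure)
  also have "\<dots> = (\<integral>\<^sup>+s. ennreal (?g s) * indicator {0<..t} s * indicator ?S s \<partial>count_space UNIV)"
    by (rule nn_integral_count_space_indicator) simp
  also have "\<dots> = (\<integral>\<^sup>+s. ennreal (?g s) * indicator {0<..t} s \<partial>count_space UNIV)"
    by (intro nn_integral_cong) (auto simp: indicator_def)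
  also have "\<dots> = (\<integral>\<^sup>+s. ennreal (?g s) \<partial>count_space {0<..t})"
    by (rule nn_integral_count_space_indicator[symmetric]) simp
  also have "\<dots> = ennreal (l * J)"
  proof -
    have hs: "(?g has_sum (l * J)) {0<..t}"
      using sum by (rule has_sum_cmult_right)
    have abs: "Infinite_Set_Sum.abs_summable_on ?g {0<..t}"
      by (rule iffD1[OF abs_summable_equivalent
            iffD1[OF summable_on_iff_abs_summable_on_real has_sum_imp_summable[OF hs]]])
    have "(\<integral>\<^sup>+s. ennreal (?g s) \<partial>count_space {0<..t}) = ennreal (infsetsum ?g {0<..t})"
      using abs path_jump_nonneg[OF x] l by (intro nn_integral_conv_infsetsum) auto
    also have "infsetsum ?g {0<..t} = l * J"
      using infsetsum_infsum[OF abs] infsumI[OF hs] by simp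
    finally show ?thesis .
  qed
  finally show ?thesis .
qed

locale drifting_subordinator =
  fixes M :: "'a measure" and X :: "real \<Rightarrow> 'a \<Rightarrow> real" and \<nu> :: "real measure"
    and \<delta> q :: real
  assumes sub: "subordinator M X"
    and levy: "has_drift_and_levy_measure M X \<delta> \<nu>"
    and drift: "\<delta> > 0" and killing: "q \<ge> 0"
begin

sublocale prob_space M
  using sub by (simp add: subordinator_def levy_process_def)

lemma X_measurable: "t \<ge> 0 \<Longrightarrow> X t \<in> borel_measurable M"
  using sub by (simp add: subordinator_def levy_process_def)

lemma AE_path: "AE \<omega> in M. X 0 \<omega> = 0 \<and> cadlag (\<lambda>t. X t \<omega>) \<and> mono_on {0..} (\<lambda>t. X t \<omega>)"
  using sub by (auto simp: subordinator_def levy_process_def)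

lemma nu_levy: "subordinator_levy_measure \<nu>"
  using levy by (simp add: has_drift_and_levy_measure_def)

text \<open>Apply the Laplace functional to \<open>f (s, x) = l x\<close> on \<open>0 < s \<le> t\<close>: its integral against the jumps is \<open>l\<close> times the
  jump part of \<open>X t\<close>, and its intensity integral is \<open>t\<close> times the jump part of the Laplace exponent.\<close>

lemma subordinator_laplace_transform:
  assumes t: "t \<ge> 0" and l: "l > 0"
  shows "(\<integral>\<^sup>+\<omega>. ennreal (exp (- l * X t \<omega>)) \<partial>M)
       = ennreal (exp (- (t * (l * (\<delta> + enn2real (laplace (density lborel (pos_ext (levy_tail \<nu>))) l))))))"
proof -
  let ?\<mu> = "density lborel (indicator {0<..}) \<Otimes>\<^sub>M \<nu>"
  let ?f = "\<lambda>p. ennreal (l * snd p) * indicator {0<..t} (fst p)"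
  define L where "L = enn2real (laplace (density lborel (pos_ext (levy_tail \<nu>))) l)"
  have L: "laplace (density lborel (pos_ext (levy_tail \<nu>))) l = ennreal L" "L \<ge> 0"
    using laplace_levy_tail(2)[OF nu_levy l] by (auto simp: L_def less_top)
  obtain N where N: "poisson_random_measure M ?\<mu> N" "AE \<omega> in M. N \<omega> = jump_measure (\<lambda>t. X t \<omega>)"
    using levy by (auto simp: has_drift_and_levy_measure_def)
  have jumps: "AE \<omega> in M. \<forall>t\<ge>0. (path_jump (\<lambda>r. X r \<omega>) has_sum (X t \<omega> - \<delta> * t)) {0<..t}"
    using levy by (simp add: has_drift_and_levy_measure_def)
  have [measurable_cong]: "sets \<nu> = sets borel" by (rule levy_sets[OF nu_levy])
  have fst: "fst \<in> borel_measurable ?\<mu>" and snd: "snd \<in> borel_measurable ?\<mu>"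
    using measurable_fst[of "density lborel (indicator {0<..})" \<nu>] 
    by (simp, subst measurable_cong_sets[OF refl levy_sets[OF nu_levy, symmetric]]) (rule measurable_snd)
  have [measurable]: "(\<lambda>p. ennreal (l * snd p)) \<in> borel_measurable ?\<mu>"
    by (rule measurable_compose[OF snd]) measurable
  have [measurable]: "(\<lambda>p. indicator {0<..t} (fst p) :: ennreal) \<in> borel_measurable ?\<mu>"
    by (rule measurable_compose[OF fst]) measurable
  have f [measurable]: "?f \<in> borel_measurable ?\<mu>" by measurable
  interpret \<nu>: sigma_finite_measure \<nu> by (rule levy_sigma_finite[OF nu_levy])
  have "(\<integral>\<^sup>+\<omega>. ennreal (exp (- l * X t \<omega>)) \<partial>M)
      = (\<integral>\<^sup>+\<omega>. ennreal (exp (- l * \<delta> * t)) * expneg (\<integral>\<^sup>+p. ?f p \<partial>N \<omega>) \<partial>M)"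
  proof (rule nn_integral_cong_AE, use N(2) AE_path jumps in eventually_elim)
    case (elim \<omega>)
    let ?J = "X t \<omega> - \<delta> * t"
    have sum: "(path_jump (\<lambda>r. X r \<omega>) has_sum ?J) {0<..t}" using elim t by auto
    have "?J \<ge> 0"
      using elim by (intro has_sum_nonneg[OF sum] path_jump_nonneg) auto
    have "(\<integral>\<^sup>+p. ?f p \<partial>N \<omega>) = ennreal (l * ?J)"
      using elim nn_integral_jump_measure[OF _ _ sum] l by simp
    then show ?case
      using \<open>?J \<ge> 0\<close> l by (simp add: expneg_ennreal ennreal_mult[symmetric] exp_add[symmetric] algebra_simps)
  qed
  also have "\<dots> = ennreal (exp (- l * \<delta> * t)) * (\<integral>\<^sup>+\<omega>. expneg (\<integral>\<^sup>+p. ?f p \<partial>N \<omega>) \<partial>M)"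
    by (rule nn_integral_cmult)
      (rule measurable_compose[OF prm_integral_measurable[OF prob_space_axioms N(1) f] measurable_expneg])
  also have "(\<integral>\<^sup>+\<omega>. expneg (\<integral>\<^sup>+p. ?f p \<partial>N \<omega>) \<partial>M) = expneg (\<integral>\<^sup>+p. (1 - expneg (?f p)) \<partial>?\<mu>)"
    by (rule prm_laplace_functional[OF prob_space_axioms N(1) f])
  also have "(\<integral>\<^sup>+p. (1 - expneg (?f p)) \<partial>?\<mu>)
      = (\<integral>\<^sup>+s. (\<integral>\<^sup>+x. (1 - expneg (?f (s, x))) \<partial>\<nu>) \<partial>density lborel (indicator {0<..}))"
    by (rule \<nu>.nn_integral_fst[symmetric]) measurable
  also have "\<dots> = (\<integral>\<^sup>+s. ennreal (l * L) * indicator {0<..t} s \<partial>density lborel (indicator {0<..}))"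
  proof (rule nn_integral_cong)
    fix s
    have "(\<integral>\<^sup>+x. (1 - expneg (ennreal (l * x))) \<partial>\<nu>) = ennreal (l * L)"
      using laplace_levy_tail(1)[OF nu_levy l] l L by (simp add: ennreal_mult)
    then show "(\<integral>\<^sup>+x. (1 - expneg (?f (s, x))) \<partial>\<nu>) = ennreal (l * L) * indicator {0<..t} s"
      by (cases "s \<in> {0<..t}") auto
  qed
  also have "\<dots> = (\<integral>\<^sup>+s. ennreal (l * L) * indicator {0<..t} s \<partial>lborel)"
    by (subst nn_integral_density) (auto intro!: nn_integral_cong simp: indicator_def)
  also have "\<dots> = ennreal (l * L * t)"
    using t l L by (simp add: nn_integral_cmult_indicator ennreal_mult)
  finally show ?thesis
    using t l L by (simp add: expneg_ennreal ennreal_mult[symmetric] exp_add[symmetric] algebra_simps flip: L_def)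
qed

text \<open>The order of integration over time and over \<open>M\<close> can only be exchanged for a jointly measurable process.  Sampling the
  path at the first grid point strictly to the right of \<open>t\<close> is jointly measurable, and converges to \<open>X t\<close> by
  right-continuity outside a null set.\<close>

definition grid_version :: "nat \<Rightarrow> real \<times> 'a \<Rightarrow> real" where
  "grid_version n p = X (real (Suc (nat \<lfloor>fst p * real (Suc n)\<rfloor>)) / real (Suc n)) (snd p)"

definition joint_version :: "real \<times> 'a \<Rightarrow> real" where
  "joint_version p = lim (\<lambda>n. grid_version n p)"

lemma measurable_joint_version [measurable]:
  "joint_version \<in> borel_measurable (lborel \<Otimes>\<^sub>M M)"
proof -
  have "grid_version n \<in> borel_measurable (lborel \<Otimes>\<^sub>M M)" for n
  proof -
    have sample: "(\<lambda>p. X (real (Suc i) / real (Suc n)) (snd p)) \<in> borel_measurable (lborel \<Otimes>\<^sub>M M)" for i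
      by (rule measurable_compose[OF measurable_snd X_measurable]) simp
    have "(\<lambda>t. nat \<lfloor>t * real (Suc n)\<rfloor>) \<in> measurable lborel (count_space UNIV)"
      by (rule measurable_compose[of "\<lambda>t. t * real (Suc n)" _ borel, OF _
            measurable_compose[OF measurable_real_floor measurable_count_space]]) simp
    from measurable_compose_countable[where f = "\<lambda>i p. X (real (Suc i) / real (Suc n)) (snd p)",
        OF sample measurable_compose[OF measurable_fst this]]
    show ?thesis by (simp only: grid_version_def[abs_def])
  qed
  then show ?thesis
    unfolding joint_version_def by (rule borel_measurable_lim_metric)
qed

lemma AE_joint_version: "AE \<omega> in M. \<forall>t\<ge>0. joint_version (t, \<omega>) = X t \<omega>"
  using AE_path
proof eventually_elim
  case (elim \<omega>)
  show ?case
  proof (intro allI impI)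
    fix t :: real assume t: "t \<ge> 0"
    let ?s = "\<lambda>n. real (Suc (nat \<lfloor>t * real (Suc n)\<rfloor>)) / real (Suc n)"
    have s: "t < ?s n" "?s n \<le> t + 1 / real (Suc n)" for n
    proof -
      define m c where "m = nat \<lfloor>t * real (Suc n)\<rfloor>" and "c = real (Suc n)"
      have c: "c > 0" by (simp add: c_def)
      have "real m = of_int \<lfloor>t * c\<rfloor>"
        using t c unfolding m_def c_def by (intro of_nat_nat) (simp del: of_nat_Suc)
      then have "t * c < real m + 1" "real m \<le> t * c" by linarith+
      then have "t < (real m + 1) / c" "(real m + 1) / c \<le> t + 1 / c"
        using c by (simp_all add: field_simps)
      then show "t < ?s n" "?s n \<le> t + 1 / real (Suc n)"
        by (simp_all add: m_def c_def add.commute)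
    qed
    have "?s \<longlonglongrightarrow> t"
    proof (rule tendsto_sandwich[OF _ _ tendsto_const])
      show "\<forall>\<^sub>F n in sequentially. t \<le> ?s n" "\<forall>\<^sub>F n in sequentially. ?s n \<le> t + 1 / real (Suc n)"
        by (rule always_eventually, rule allI, rule less_imp_le, rule s)
          (rule always_eventually, rule allI, rule s)
      show "(\<lambda>n. t + 1 / real (Suc n)) \<longlonglongrightarrow> t"
        using tendsto_add[OF tendsto_const LIMSEQ_inverse_real_of_nat, of t] by (simp add: inverse_eq_divide)
    qed
    then have "filterlim ?s (at_right t) sequentially"
      by (intro tendsto_imp_filterlim_at_right always_eventually allI s)
    moreover have "((\<lambda>t. X t \<omega>) \<longlongrightarrow> X t \<omega>) (at_right t)"
      using elim t by (auto simp: cadlag_def continuous_within)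
    ultimately have "(\<lambda>n. X (?s n) \<omega>) \<longlonglongrightarrow> X t \<omega>"
      by (rule filterlim_compose[rotated])
    then show "joint_version (t, \<omega>) = X t \<omega>"
      unfolding joint_version_def grid_version_def fst_conv snd_conv by (rule limI)
  qed
qed

lemma sets_potential_measure: "sets (potential_measure M X q) = sets borel"
  unfolding potential_measure_def
  by (subst sets_measure_of) (use sets.sigma_sets_eq[of "borel :: real measure"] in simp_all)

text \<open>For the jointly measurable version the defining set function is the image of the measure with density \<open>exp (-q t)\<close>
  on \<open>[0,\<infinity>)\<close> times \<open>M\<close>.  In particular it is countably additive, so that \<open>measure_of\<close> does not
  degenerate.\<close>

lemma nn_integral_potential_measure:
  assumes [measurable]: "f \<in> borel_measurable borel"
  shows "(\<integral>\<^sup>+x. f x \<partial>potential_measure M X q)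
       = (\<integral>\<^sup>+t. ennreal (exp (- q * t)) * indicator {0..} t * (\<integral>\<^sup>+\<omega>. f (X t \<omega>) \<partial>M) \<partial>lborel)"
proof -
  interpret P: pair_sigma_finite lborel M ..
  let ?w = "\<lambda>t. ennreal (exp (- q * t)) * indicator {0..} t"
  define Q where "Q = distr (density (lborel \<Otimes>\<^sub>M M) (\<lambda>p. ?w (fst p))) borel joint_version"
  have [measurable]: "(\<lambda>p. fst p) \<in> borel_measurable (lborel \<Otimes>\<^sub>M M)"
    using measurable_fst[of lborel M] by simp
  have w [measurable]: "(\<lambda>p. ?w (fst p)) \<in> borel_measurable (lborel \<Otimes>\<^sub>M M)" by measurable
  have jv [measurable]: "joint_version \<in> measurable (density (lborel \<Otimes>\<^sub>M M) (\<lambda>p. ?w (fst p))) borel"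
    using measurable_joint_version by simp
  have Q: "(\<integral>\<^sup>+x. g x \<partial>Q) = (\<integral>\<^sup>+p. ?w (fst p) * g (joint_version p) \<partial>(lborel \<Otimes>\<^sub>M M))"
    if [measurable]: "g \<in> borel_measurable borel" for g
    unfolding Q_def by (subst nn_integral_distr) (auto simp: nn_integral_density)
  have "potential_measure M X q = measure_of UNIV (sets borel) (emeasure Q)"
    unfolding potential_measure_def
  proof (rule measure_of_eq)
    fix A :: "real set" assume "A \<in> sigma_sets UNIV (sets borel)"
    then have [measurable]: "A \<in> sets borel"
      using sets.sigma_sets_eq[of "borel :: real measure"] by simp
    have "emeasure Q A = (\<integral>\<^sup>+x. indicator A x \<partial>Q)" by (simp add: Q_def)
    also have "\<dots> = (\<integral>\<^sup>+p. ?w (fst p) * indicator A (joint_version p) \<partial>(lborel \<Otimes>\<^sub>M M))"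
      by (rule Q) measurable
    also have "\<dots> = (\<integral>\<^sup>+\<omega>. (\<integral>\<^sup>+t. ?w t * indicator A (joint_version (t, \<omega>)) \<partial>lborel) \<partial>M)"
      by (subst P.nn_integral_snd[symmetric]) auto
    also have "\<dots> = (\<integral>\<^sup>+\<omega>. (\<integral>\<^sup>+t. ennreal (exp (- q * t)) * indicator A (X t \<omega>) * indicator {0..} t \<partial>lborel) \<partial>M)"
    proof (rule nn_integral_cong_AE, use AE_joint_version in eventually_elim)
      case (elim \<omega>)
      then show ?case by (intro nn_integral_cong) (auto simp: indicator_def)
    qed
    finally show "(\<integral>\<^sup>+\<omega>. (\<integral>\<^sup>+t. ennreal (exp (- q * t)) * indicator A (X t \<omega>) * indicator {0..} t \<partial>lborel) \<partial>M) = emeasure Q A" ..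
  qed simp
  also have "\<dots> = Q"
    using measure_of_of_measure[of Q] by (simp add: Q_def)
  finally have "(\<integral>\<^sup>+x. f x \<partial>potential_measure M X q) = (\<integral>\<^sup>+p. ?w (fst p) * f (joint_version p) \<partial>(lborel \<Otimes>\<^sub>M M))"
    using Q by simp
  also have "\<dots> = (\<integral>\<^sup>+t. (\<integral>\<^sup>+\<omega>. ?w t * f (joint_version (t, \<omega>)) \<partial>M) \<partial>lborel)"
    by (subst nn_integral_fst[symmetric]) auto
  also have "\<dots> = (\<integral>\<^sup>+t. ?w t * (\<integral>\<^sup>+\<omega>. f (X t \<omega>) \<partial>M) \<partial>lborel)"
  proof (rule nn_integral_cong)
    fix t :: real
    show "(\<integral>\<^sup>+\<omega>. ?w t * f (joint_version (t, \<omega>)) \<partial>M) = ?w t * (\<integral>\<^sup>+\<omega>. f (X t \<omega>) \<partial>M)"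
    proof (cases "t \<ge> 0")
      case True
      then have [measurable]: "X t \<in> borel_measurable M" by (rule X_measurable)
      have "(\<integral>\<^sup>+\<omega>. ?w t * f (joint_version (t, \<omega>)) \<partial>M) = (\<integral>\<^sup>+\<omega>. ?w t * f (X t \<omega>) \<partial>M)"
        using AE_joint_version by (rule nn_integral_cong_AE[OF eventually_mono]) (simp add: True)
      then show ?thesis by (simp add: nn_integral_cmult)
    qed simp
  qed
  finally show ?thesis .
qed

lemma AE_potential_measure_nonneg: "AE x in potential_measure M X q. 0 \<le> x"
proof -
  have "(\<integral>\<^sup>+x. indicator {..<0} x \<partial>potential_measure M X q) = (\<integral>\<^sup>+t. 0 \<partial>(lborel :: real measure))"
  proof (subst nn_integral_potential_measure, measurable, rule nn_integral_cong)
    fix t :: real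
    show "ennreal (exp (- q * t)) * indicator {0..} t * (\<integral>\<^sup>+\<omega>. indicator {..<0} (X t \<omega>) \<partial>M) = 0"
    proof (cases "t \<ge> 0")
      case True
      have "AE \<omega> in M. indicator {..<0} (X t \<omega>) = (0 :: ennreal)"
        using AE_path
      proof eventually_elim
        case (elim \<omega>)
        then have "X 0 \<omega> \<le> X t \<omega>" using True by (intro mono_onD[of "{0..}" "\<lambda>t. X t \<omega>"]) auto
        with elim show ?case by simp
      qed
      then have "(\<integral>\<^sup>+\<omega>. indicator {..<0} (X t \<omega>) \<partial>M) = (\<integral>\<^sup>+\<omega>. (0 :: ennreal) \<partial>M)"
        by (rule nn_integral_cong_AE)
      then show ?thesis by simp
    qed simp
  qed
  then have "emeasure (potential_measure M X q) {..<0} = 0"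
    by (simp add: sets_potential_measure)
  then have "AE x in potential_measure M X q. x \<notin> {..<0}"
    by (intro AE_not_in) (simp add: null_sets_def sets_potential_measure)
  then show ?thesis by eventually_elim auto
qed

lemma laplace_potential_measure:
  assumes l: "l > 0"
  shows "laplace (potential_measure M X q) l
    = ennreal (1 / (q + l * (\<delta> + enn2real (laplace (density lborel (pos_ext (levy_tail \<nu>))) l))))"
proof -
  define \<phi> where "\<phi> = l * (\<delta> + enn2real (laplace (density lborel (pos_ext (levy_tail \<nu>))) l))"
  have "\<phi> > 0" unfolding \<phi>_def using l drift by (intro mult_pos_pos add_pos_nonneg) auto
  have "laplace (potential_measure M X q) l
      = (\<integral>\<^sup>+t. ennreal (exp (- q * t)) * indicator {0..} t * (\<integral>\<^sup>+\<omega>. ennreal (exp (- l * X t \<omega>)) \<partial>M) \<partial>lborel)"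
    unfolding laplace_def by (rule nn_integral_potential_measure) measurable
  also have "\<dots> = (\<integral>\<^sup>+t. ennreal (exp (- (q + \<phi>) * t)) * indicator {0<..} t \<partial>lborel)"
  proof (rule nn_integral_cong_AE, use AE_lborel_singleton[of 0] in eventually_elim)
    fix t :: real assume t: "t \<noteq> 0"
    show "ennreal (exp (- q * t)) * indicator {0..} t * (\<integral>\<^sup>+\<omega>. ennreal (exp (- l * X t \<omega>)) \<partial>M)
        = ennreal (exp (- (q + \<phi>) * t)) * indicator {0<..} t"
    proof (cases "t > 0")
      case True
      then show ?thesis
        using subordinator_laplace_transform[OF less_imp_le l, of t]
        by (simp add: ennreal_mult[symmetric] exp_add[symmetric] algebra_simps \<phi>_def)
    qed (use t in auto)
  qed
  also have "\<dots> = ennreal (1 / (q + \<phi>))"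
    using killing \<open>\<phi> > 0\<close> by (intro nn_integral_exp_decay) auto
  finally show ?thesis by (simp add: \<phi>_def)
qed

section \<open>Renewal equation for the potential density\<close>

abbreviation killed_tail :: "real \<Rightarrow> real" where
  "killed_tail \<equiv> \<lambda>y. q + levy_tail \<nu> y"

lemma killed_tail_nonneg: "0 \<le> killed_tail x"
  using killing by (simp add: levy_tail_def)

lemma killed_tail_antimono: "0 < x \<Longrightarrow> x \<le> y \<Longrightarrow> killed_tail y \<le> killed_tail x"
  using levy_tail_antimono[OF nu_levy] by simp

lemma pos_ext_killed_tail: "pos_ext killed_tail = (\<lambda>y. ennreal q * unit_step y + pos_ext (levy_tail \<nu>) y)"
  using killing by (auto simp: pos_ext_def indicator_def levy_tail_def fun_eq_iff)

lemma measurable_killed_tail [measurable]: "pos_ext killed_tail \<in> borel_measurable borel"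
  unfolding pos_ext_killed_tail using measurable_pos_ext_levy_tail[OF nu_levy] by measurable

lemma killed_tail_locally_integrable: "nconv unit_step (pos_ext killed_tail) x < \<infinity>"
proof -
  note [measurable] = measurable_pos_ext_levy_tail[OF nu_levy]
  have "nconv unit_step (pos_ext killed_tail) x
      = ennreal q * nconv unit_step unit_step x + nconv unit_step (pos_ext (levy_tail \<nu>)) x"
    unfolding pos_ext_killed_tail by (simp add: nconv_add_right nconv_cmult_right)
  moreover have "nconv unit_step unit_step x \<le> (\<integral>\<^sup>+y. indicator {0..max 0 x} y \<partial>lborel)"
    unfolding unit_step_nconv by (intro nn_integral_mono) (auto simp: indicator_def)
  then have "nconv unit_step unit_step x < \<infinity>"
    by (auto intro: le_less_trans)
  ultimately show ?thesis
    using levy_tail_locally_integrable[OF nu_levy, of x] by (simp add: ennreal_mult_less_top)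
qed

lemma laplace_killed_tail:
  assumes l: "l > 0"
  shows "laplace (density lborel (pos_ext killed_tail)) l
       = ennreal (q / l + enn2real (laplace (density lborel (pos_ext (levy_tail \<nu>))) l))"
proof -
  note [measurable] = measurable_pos_ext_levy_tail[OF nu_levy]
  have "laplace (density lborel (pos_ext killed_tail)) l
      = ennreal q * (\<integral>\<^sup>+x. ennreal (exp (- l * x)) * unit_step x \<partial>lborel)
        + laplace (density lborel (pos_ext (levy_tail \<nu>))) l"
    unfolding laplace_density[OF measurable_killed_tail] laplace_density[OF measurable_pos_ext_levy_tail[OF nu_levy]]
    by (simp add: pos_ext_killed_tail distrib_left mult.left_commute nn_integral_add nn_integral_cmult)
  also have "\<dots> = ennreal (q / l) + laplace (density lborel (pos_ext (levy_tail \<nu>))) l"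
    using l killing by (simp only: nn_integral_exp_decay) (simp add: ennreal_mult[symmetric])
  also have "\<dots> = ennreal (q / l + enn2real (laplace (density lborel (pos_ext (levy_tail \<nu>))) l))"
    using laplace_levy_tail(2)[OF nu_levy l] l killing by (simp add: less_top)
  finally show ?thesis .
qed

lemma potential_sigma_finite: "sigma_finite_measure (potential_measure M X q)"
proof (rule sigma_finite_of_integrable_positive)
  show "(\<lambda>x. exp (- 1 * x)) \<in> borel_measurable (potential_measure M X q)"
    by (subst measurable_cong_sets[OF sets_potential_measure refl]) measurable
  show "(\<integral>\<^sup>+x. ennreal (exp (- 1 * x)) \<partial>potential_measure M X q) < \<infinity>"
    using laplace_potential_measure[of 1] by (simp add: laplace_def)
qed simp

text \<open>The renewal equation as an identity of measures.  Both sides have Laplace transform \<open>1 / l\<close>, by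
  \<open>\<delta> + q / l + L l = (q + l (\<delta> + L l)) / l\<close>.\<close>

lemma potential_renewal_measure:
  fixes U K
  defines "U \<equiv> potential_measure M X q"
    and "K \<equiv> (\<lambda>x. \<integral>\<^sup>+y. pos_ext killed_tail (x - y) \<partial>potential_measure M X q)"
  shows "K \<in> borel_measurable borel"
    and "A \<in> sets borel \<Longrightarrow>
      ennreal \<delta> * emeasure U A + emeasure (density lborel K) A = emeasure (density lborel unit_step) A"
proof -
  have sU [measurable_cong]: "sets U = sets borel"
    unfolding U_def by (rule sets_potential_measure)
  interpret U: sigma_finite_measure U
    unfolding U_def by (rule potential_sigma_finite)
  interpret P: pair_sigma_finite U lborel ..
  have pair: "sets (borel \<Otimes>\<^sub>M U) = sets (borel \<Otimes>\<^sub>M borel)" "sets (U \<Otimes>\<^sub>M lborel) = sets (borel \<Otimes>\<^sub>M borel)"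
    by (intro sets_pair_measure_cong; simp add: sU)+
  show K [measurable]: "K \<in> borel_measurable borel"
    unfolding K_def U_def[symmetric]
    by (rule U.borel_measurable_nn_integral, subst measurable_cong_sets[OF pair(1) refl]) measurable
  let ?m = "measure_add (density U (\<lambda>_. ennreal \<delta>)) (density lborel K)"
  have s1: "sets (density U (\<lambda>_. ennreal \<delta>)) = sets (density lborel K)" by (simp add: sU)
  have sm [measurable_cong]: "sets ?m = sets borel"
    using sets_measure_add[OF s1] by (simp add: sU)
  have lapK: "laplace (density lborel K) l = laplace U l * laplace (density lborel (pos_ext killed_tail)) l" for l
  proof -
    have "laplace (density lborel K) l = (\<integral>\<^sup>+x. (\<integral>\<^sup>+y. ennreal (exp (- l * x)) * pos_ext killed_tail (x - y) \<partial>U) \<partial>lborel)"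
      unfolding laplace_density[OF K]
      by (intro nn_integral_cong, unfold K_def U_def[symmetric], rule nn_integral_cmult[symmetric],
          subst measurable_cong_sets[OF sU refl]) measurable
    also have "\<dots> = (\<integral>\<^sup>+y. (\<integral>\<^sup>+x. ennreal (exp (- l * x)) * pos_ext killed_tail (x - y) \<partial>lborel) \<partial>U)"
      by (rule P.Fubini', subst measurable_cong_sets[OF pair(2) refl]) measurable
    also have "\<dots> = (\<integral>\<^sup>+y. ennreal (exp (- l * y)) * laplace (density lborel (pos_ext killed_tail)) l \<partial>U)"
    proof (rule nn_integral_cong)
      fix y
      have "(\<integral>\<^sup>+x. ennreal (exp (- l * x)) * pos_ext killed_tail (x - y) \<partial>lborel)
          = ennreal \<bar>1\<bar> * (\<integral>\<^sup>+x. ennreal (exp (- l * (y + 1 * x))) * pos_ext killed_tail (y + 1 * x - y) \<partial>lborel)"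
        by (rule nn_integral_real_affine) auto
      also have "\<dots> = (\<integral>\<^sup>+x. ennreal (exp (- l * y)) * (ennreal (exp (- l * x)) * pos_ext killed_tail x) \<partial>lborel)"
        by (simp add: mult.assoc[symmetric] ennreal_mult[symmetric] exp_add[symmetric] algebra_simps)
      also have "\<dots> = ennreal (exp (- l * y)) * laplace (density lborel (pos_ext killed_tail)) l"
        unfolding laplace_density[OF measurable_killed_tail] by (rule nn_integral_cmult) simp
      finally show "(\<integral>\<^sup>+x. ennreal (exp (- l * x)) * pos_ext killed_tail (x - y) \<partial>lborel)
          = ennreal (exp (- l * y)) * laplace (density lborel (pos_ext killed_tail)) l" .
    qed
    also have "\<dots> = laplace U l * laplace (density lborel (pos_ext killed_tail)) l"
      unfolding laplace_def[of U]
      by (rule nn_integral_multc, subst measurable_cong_sets[OF sU refl]) measurable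
    finally show ?thesis .
  qed
  have lap: "laplace ?m l = laplace (density lborel unit_step) l" if l: "l > 0" for l
  proof -
    define L where "L = enn2real (laplace (density lborel (pos_ext (levy_tail \<nu>))) l)"
    have L: "L \<ge> 0" by (simp add: L_def)
    have U: "laplace U l = ennreal (1 / (q + l * (\<delta> + L)))"
      unfolding U_def L_def by (rule laplace_potential_measure[OF l])
    have pos: "q + l * (\<delta> + L) > 0"
      using l drift killing L by (intro add_nonneg_pos mult_pos_pos add_pos_nonneg)
    have "laplace ?m l = laplace (density U (\<lambda>_. ennreal \<delta>)) l + laplace (density lborel K) l"
      unfolding laplace_def by (rule nn_integral_measure_add[OF s1])
        (simp add: measurable_cong_sets[OF sU refl])
    also have "laplace (density U (\<lambda>_. ennreal \<delta>)) l = ennreal \<delta> * laplace U l"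
      unfolding laplace_def
      by (simp add: nn_integral_density nn_integral_cmult measurable_cong_sets[OF sU refl])
    also have "ennreal \<delta> * laplace U l + laplace (density lborel K) l
        = ennreal (\<delta> * (1 / (q + l * (\<delta> + L))) + 1 / (q + l * (\<delta> + L)) * (q / l + L))"
      unfolding lapK U laplace_killed_tail[OF l] L_def[symmetric]
      using pos drift l killing L by (simp add: ennreal_mult'[symmetric] ennreal_plus[symmetric] del: ennreal_plus)
    also have "\<delta> * (1 / (q + l * (\<delta> + L))) + 1 / (q + l * (\<delta> + L)) * (q / l + L) = 1 / l"
    proof -
      have "\<delta> * (1 / (q + l * (\<delta> + L))) + 1 / (q + l * (\<delta> + L)) * (q / l + L)
          = (\<delta> + (q / l + L)) / (q + l * (\<delta> + L))"
        by (simp add: add_divide_distrib)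
      also have "\<delta> + (q / l + L) = (q + l * (\<delta> + L)) / l"
        using l by (simp add: field_simps)
      finally show ?thesis using pos by simp
    qed
    also have "ennreal (1 / l) = laplace (density lborel unit_step) l"
      using nn_integral_exp_decay[OF l] by (simp add: laplace_density)
    finally show ?thesis .
  qed
  have eq: "?m = density lborel unit_step"
  proof (rule laplace_unique)
    have U0: "AE y in U. 0 \<le> y"
      unfolding U_def by (rule AE_potential_measure_nonneg)
    have "K x = 0" if "x < 0" for x
    proof -
      have "K x = (\<integral>\<^sup>+y. 0 \<partial>U)"
        unfolding K_def U_def[symmetric] using U0 that
        by (intro nn_integral_cong_AE) (auto elim!: eventually_mono)
      then show ?thesis by simp
    qed
    then have "(\<lambda>x. K x * indicator {..<0} x) = (\<lambda>_. 0)"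
      by (auto simp: fun_eq_iff split: split_indicator)
    then have "emeasure (density lborel K) {..<0} = 0"
      by (subst emeasure_density) simp_all
    moreover have "emeasure U {..<0} = 0"
      using U0 by (subst (asm) AE_iff_measurable[where N = "{..<0}"]) (auto simp: sU sets_eq_imp_space_eq[OF sU])
    ultimately have "emeasure ?m {..<0} = 0"
      by (simp add: emeasure_measure_add[OF s1] sU emeasure_density_const)
    then have "AE x in ?m. x \<notin> {..<0}"
      by (intro AE_not_in) (simp add: null_sets_def sm)
    then show "AE x in ?m. 0 \<le> x" by eventually_elim auto
    show "AE x in density lborel unit_step. (0::real) \<le> x"
      by (subst AE_density) (auto simp: indicator_def)
    show "laplace ?m 1 < \<infinity>"
      unfolding lap[OF zero_less_one] laplace_density[OF borel_measurable_indicator[of "{0<..}"], simplified]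
      using nn_integral_exp_decay[of 1] by simp
  qed (auto simp: sm lap)
  assume [measurable]: "A \<in> sets borel"
  have "emeasure ?m A = ennreal \<delta> * emeasure U A + emeasure (density lborel K) A"
    by (subst emeasure_measure_add[OF s1]) (auto simp: sU emeasure_density_const)
  then show "ennreal \<delta> * emeasure U A + emeasure (density lborel K) A = emeasure (density lborel unit_step) A"
    by (simp only: eq)
qed

text \<open>The identity of measures makes \<open>U\<close> absolutely continuous and gives the renewal equation almost everywhere for any
  density.  Read as a definition of the density it holds everywhere, as soon as \<open>U * g \<le> 1\<close> does; this bound
  extends from almost every point to every point by continuity.\<close>

lemma potential_density_renewal:
  obtains u where "continuous_on {0<..} u" "\<And>x. x > 0 \<Longrightarrow> 0 \<le> u x" "\<And>x. x > 0 \<Longrightarrow> u x \<le> 1 / \<delta>"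
    "pos_ext u \<in> borel_measurable borel"
    "potential_measure M X q = density lborel (pos_ext u)"
    "\<And>x. x > 0 \<Longrightarrow> ennreal \<delta> * pos_ext u x + nconv (pos_ext killed_tail) (pos_ext u) x = 1"
proof -
  let ?G = "pos_ext killed_tail"
  define U where "U = potential_measure M X q"
  define K where "K x = (\<integral>\<^sup>+y. ?G (x - y) \<partial>U)" for x
  have sU [measurable_cong]: "sets U = sets borel"
    unfolding U_def by (rule sets_potential_measure)
  have K [measurable]: "K \<in> borel_measurable borel"
    and renewal: "A \<in> sets borel \<Longrightarrow>
      ennreal \<delta> * emeasure U A + emeasure (density lborel K) A = emeasure (density lborel unit_step) A" for A
    using potential_renewal_measure by (simp_all add: U_def K_def[abs_def])
  interpret U: sigma_finite_measure U
    unfolding U_def by (rule potential_sigma_finite)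
  have "absolutely_continuous lborel U"
    unfolding absolutely_continuous_def
  proof
    fix A :: "real set" assume A: "A \<in> null_sets lborel"
    then have [measurable]: "A \<in> sets borel" by auto
    have "emeasure (density lborel unit_step) A = 0"
      using absolutely_continuousI_density[of "unit_step" lborel] A
      by (auto simp: absolutely_continuous_def)
    then have "ennreal \<delta> * emeasure U A = 0"
      using renewal[of A] by simp
    then show "A \<in> null_sets U" using drift by (simp add: null_sets_def sU)
  qed
  then have U_RN: "density lborel (RN_deriv lborel U) = U"
    by (intro sigma_finite_measure.density_RN_deriv[OF lborel.sigma_finite_measure_axioms]) (simp_all add: sU)
  define f where "f = RN_deriv lborel U"
  have f [measurable]: "f \<in> borel_measurable borel"
    using borel_measurable_RN_deriv[of lborel U] by (simp add: f_def)
  have U: "U = density lborel f" using U_RN by (simp add: f_def)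
  have K_f: "K = nconv ?G f"
    by (rule ext) (simp add: K_def U nn_integral_density nconv_def mult.commute)
  have "density lborel (\<lambda>x. ennreal \<delta> * f x + K x) = density lborel unit_step"
  proof (rule measure_eqI)
    fix A assume "A \<in> sets (density lborel (\<lambda>x. ennreal \<delta> * f x + K x))"
    then have [measurable]: "A \<in> sets borel" by simp
    have "emeasure (density lborel (\<lambda>x. ennreal \<delta> * f x + K x)) A
        = ennreal \<delta> * emeasure U A + emeasure (density lborel K) A"
      by (simp add: U emeasure_density distrib_right nn_integral_add nn_integral_cmult mult.assoc)
    then show "emeasure (density lborel (\<lambda>x. ennreal \<delta> * f x + K x)) A = emeasure (density lborel unit_step) A"
      using renewal by simp
  qed simp
  then have AE_f: "AE x in lborel. ennreal \<delta> * f x + K x = unit_step x"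
    by (subst (asm) sigma_finite_measure.density_unique_iff[OF lborel.sigma_finite_measure_axioms]) auto
  \<comment> \<open>truncated subtraction keeps this version of the density below \<open>1 / \<delta>\<close> at every point\<close>
  define v where "v x = ennreal (1 / \<delta>) * (unit_step x - K x)" for x
  have v [measurable]: "v \<in> borel_measurable borel" unfolding v_def[abs_def] by measurable
  have inv: "ennreal (1 / \<delta>) * (ennreal \<delta> * z) = z" for z
    using drift by (simp add: mult.assoc[symmetric] ennreal_mult[symmetric])
  have AE_fv: "AE x in lborel. f x = v x"
    using AE_f
  proof eventually_elim
    case (elim x)
    have "K x \<le> unit_step x" unfolding elim[symmetric] by simp
    also have "\<dots> < \<top>" by (cases "x > 0") auto
    finally have "K x \<noteq> \<top>" by simp
    then have "unit_step x - K x = ennreal \<delta> * f x"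
      unfolding elim[symmetric] by simp
    then show ?case by (simp add: v_def inv)
  qed
  \<comment> \<open>a convolution does not see the choice of the version, so \<open>v\<close> solves the renewal equation wherever \<open>K \<le> 1\<close>\<close>
  have K_v: "K x = nconv ?G v x" for x
    unfolding K_f by (rule nconv_AE_cong[OF AE_fv])
  have v0: "v x = 0" if "x \<le> 0" for x using that by (simp add: v_def)
  have v_le: "v x \<le> ennreal (1 / \<delta>)" for x
  proof -
    have "unit_step x - K x \<le> 1"
      by (rule order_trans[OF diff_le_self_ennreal]) (simp add: indicator_def)
    then show ?thesis unfolding v_def using mult_left_mono[of "unit_step x - K x" 1 "ennreal (1 / \<delta>)"] by simp
  qed
  have K_fin: "K x < \<infinity>" for x
  proof -
    have "nconv ?G v x \<le> ennreal (1 / \<delta>) * nconv unit_step ?G x"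
      by (rule nconv_le_of_bounded) (auto simp: v0 v_le)
    also have "\<dots> < \<infinity>" using killed_tail_locally_integrable[of x] by (simp add: ennreal_mult_less_top)
    finally show ?thesis by (simp add: K_v)
  qed
  have cont: "continuous_on UNIV (\<lambda>x. enn2real (K x))"
    unfolding K_v
    by (rule enn2real_nconv_continuous[where C = "1 / \<delta>"])
      (use drift killed_tail_nonneg killed_tail_antimono killed_tail_locally_integrable v0 v_le in auto)
  have K_le: "enn2real (K x) \<le> 1" if "x > 0" for x
  proof -
    have "max (enn2real (K x)) 1 = 1"
    proof (rule continuous_eq_of_AE_eq[where f = "\<lambda>x. max (enn2real (K x)) 1" and g = "\<lambda>_. 1"])
      show "AE x in lborel. x > 0 \<longrightarrow> max (enn2real (K x)) 1 = 1"
        using AE_f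
      proof eventually_elim
        case (elim x)
        have "K x \<le> unit_step x" unfolding elim[symmetric] by simp
        also have "\<dots> \<le> 1" by (simp add: indicator_def)
        finally have "enn2real (K x) \<le> enn2real 1" by (intro enn2real_mono) auto
        then show ?case by simp
      qed
    qed (use that in \<open>auto intro!: continuous_intros continuous_on_subset[OF cont]\<close>)
    then show ?thesis by simp
  qed
  define u where "u x = (1 - enn2real (K x)) / \<delta>" for x
  have ext_u: "pos_ext u = v"
  proof
    fix x show "pos_ext u x = v x"
    proof (cases "x > 0")
      case True
      have "unit_step x - K x = ennreal (1 - enn2real (K x))"
        using True K_fin[of x] K_le[OF True]
        by (cases "K x") (auto simp: ennreal_minus simp flip: ennreal_1)
      then show ?thesis
        using True drift K_le[OF True] by (simp add: pos_ext_gt_0 v_def u_def ennreal_mult[symmetric])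
    qed (simp add: v0)
  qed
  show thesis
  proof (rule that[of u])
    show "continuous_on {0<..} u"
      unfolding u_def[abs_def] using drift by (intro continuous_intros continuous_on_subset[OF cont]) auto
    show "0 \<le> u x" "u x \<le> 1 / \<delta>" if "x > 0" for x
      using K_le[OF that] drift by (auto simp: u_def divide_right_mono)
    show "pos_ext u \<in> borel_measurable borel" by (simp add: ext_u)
    show "potential_measure M X q = density lborel (pos_ext u)"
      unfolding U_def[symmetric] U ext_u using AE_fv by (intro density_cong) auto
    show "ennreal \<delta> * pos_ext u x + nconv (pos_ext killed_tail) (pos_ext u) x = 1" if "x > 0" for x
    proof -
      have "ennreal \<delta> * pos_ext u x = ennreal (1 - enn2real (K x))"
        using that drift K_le[OF that] by (simp add: pos_ext_gt_0 u_def ennreal_mult[symmetric])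
      moreover have "nconv (pos_ext killed_tail) (pos_ext u) x = ennreal (enn2real (K x))"
        using K_fin[of x] by (simp add: ext_u K_v[symmetric] less_top)
      ultimately show ?thesis using K_le[OF that] by (simp flip: ennreal_plus)
    qed
  qed
qed

lemma potential_density_eq:
  assumes u: "continuous_on {0<..} u" "\<And>x. x > 0 \<Longrightarrow> 0 \<le> u x" "\<And>x. x > 0 \<Longrightarrow> u x \<le> 1 / \<delta>"
    and meas [measurable]: "pos_ext u \<in> borel_measurable borel"
    and dens: "potential_measure M X q = density lborel (pos_ext u)"
    and x: "x > 0"
  shows "potential_density M X q x = u x"
proof -
  have "bounded (u ` {0<..})"
    using u by (intro boundedI[of _ "1 / \<delta>"]) auto
  then have "is_potential_density M X q u"
    using u dens by (simp add: is_potential_density_def pos_ext_def[abs_def])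
  then have pd: "is_potential_density M X q (potential_density M X q)"
    unfolding potential_density_def by (rule someI[of "is_potential_density M X q" u])
  let ?w = "potential_density M X q"
  have w: "continuous_on {0<..} ?w" "\<And>x. x > 0 \<Longrightarrow> 0 \<le> ?w x" "potential_measure M X q = density lborel (pos_ext ?w)"
    using pd by (auto simp: is_potential_density_def pos_ext_def[abs_def])
  have [measurable]: "pos_ext ?w \<in> borel_measurable borel"
  proof -
    have "(\<lambda>x. indicator {0<..} x *\<^sub>R ?w x) \<in> borel_measurable borel"
      by (rule borel_measurable_continuous_on_indicator[OF _ w(1)]) simp
    moreover have "pos_ext ?w = (\<lambda>x. ennreal (indicator {0<..} x *\<^sub>R ?w x))"
      by (auto simp: pos_ext_def indicator_def)
    ultimately show ?thesis by simp
  qed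
  have "AE x in lborel. pos_ext ?w x = pos_ext u x"
    using dens w(3) by (subst sigma_finite_measure.density_unique_iff[OF lborel.sigma_finite_measure_axioms, symmetric]) auto
  then have "AE x in lborel. x > 0 \<longrightarrow> ?w x = u x"
    by eventually_elim (use u(2) w(2) in \<open>auto simp: pos_ext_gt_0\<close>)
  then show ?thesis by (rule continuous_eq_of_AE_eq[OF w(1) u(1) _ x])
qed

lemma killed_tail_pos_near_0:
  assumes "q > 0 \<or> emeasure \<nu> {0<..} \<noteq> 0"
  obtains c where "c > 0" "\<And>x. 0 < x \<Longrightarrow> x < c \<Longrightarrow> killed_tail x > 0"
proof (cases "q > 0")
  case True
  then show ?thesis using that[of 1] by (auto simp: levy_tail_def add_pos_nonneg)
next
  case False
  have nu: "subordinator_levy_measure \<nu>" by (rule nu_levy)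
  have "\<exists>n. emeasure \<nu> {1 / real (Suc n)..} \<noteq> 0"
  proof (rule ccontr)
    assume "\<not> (\<exists>n. emeasure \<nu> {1 / real (Suc n)..} \<noteq> 0)"
    then have "(\<Union>n. {1 / real (Suc n)..}) \<in> null_sets \<nu>"
      by (intro null_sets_UN) (auto simp: null_sets_def levy_sets[OF nu])
    moreover have "(\<Union>n. {1 / real (Suc n)..}) = {0<..}"
    proof safe
      fix x :: real assume "x > 0"
      then obtain n where "inverse (real (Suc n)) < x" using reals_Archimedean by blast
      then show "x \<in> (\<Union>n. {1 / real (Suc n)..})" by (auto simp: inverse_eq_divide intro!: exI[of _ n])
    qed (auto intro: less_le_trans[rotated])
    ultimately show False using False assms by auto
  qed
  then obtain n where n: "emeasure \<nu> {1 / real (Suc n)..} \<noteq> 0" by blast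
  have "levy_tail \<nu> (1 / real (Suc n)) > 0"
    using n emeasure_levy_tail[OF nu, of "1 / real (Suc n)"] levy_tail_nonneg[OF nu, of "1 / real (Suc n)"]
    by (auto simp: less_le)
  then have "killed_tail x > 0" if "0 < x" "x < 1 / real (Suc n)" for x
    using levy_tail_antimono[OF nu, of x "1 / real (Suc n)"] that killing by simp
  then show ?thesis using that[of "1 / real (Suc n)"] by simp
qed

end

section \<open>Expansion of the potential density\<close>

theorem theorem4:
  fixes M :: "'a measure" and X :: "real \<Rightarrow> 'a \<Rightarrow> real" and \<nu> :: "real measure"
    and \<delta> q :: real and n :: nat
  assumes "subordinator M X"
    and "has_drift_and_levy_measure M X \<delta> \<nu>"
    and "\<delta> > 0"
    and "q \<ge> 0"
    and "q > 0 \<or> emeasure \<nu> {0<..} \<noteq> 0"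
  shows "((\<lambda>x. ((\<Sum>k=0..n. (-1) ^ k / \<delta> ^ (k + 1) *
                     heaviside_conv_power (\<lambda>y. q + levy_tail \<nu> y) k x)
                  - potential_density M X q x)
               / ((-1) ^ n / \<delta> ^ (n + 2) *
                     heaviside_conv_power (\<lambda>y. q + levy_tail \<nu> y) (n + 1) x))
          \<longlongrightarrow> 1) (at_right 0)"
proof -
  interpret drifting_subordinator M X \<nu> \<delta> q
    by unfold_locales (use assms in auto)
  obtain u where u: "continuous_on {0<..} u" "\<And>x. x > 0 \<Longrightarrow> 0 \<le> u x" "\<And>x. x > 0 \<Longrightarrow> u x \<le> 1 / \<delta>"
    "pos_ext u \<in> borel_measurable borel"
    "potential_measure M X q = density lborel (pos_ext u)"
    "\<And>x. x > 0 \<Longrightarrow> ennreal \<delta> * pos_ext u x + nconv (pos_ext killed_tail) (pos_ext u) x = 1"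
    using potential_density_renewal by blast
  have eq: "potential_density M X q x = u x" if "x > 0" for x
    by (rule potential_density_eq[OF u(1-5) that])
  obtain c where c: "c > 0" "\<And>x. 0 < x \<Longrightarrow> x < c \<Longrightarrow> killed_tail x > 0"
    using killed_tail_pos_near_0[OF assms(5)] by blast
  have ext: "pos_ext (potential_density M X q) = pos_ext u"
    using eq by (auto simp: pos_ext_def indicator_def)
  show ?thesis
  proof (rule renewal_expansion[OF measurable_killed_tail killed_tail_nonneg killed_tail_locally_integrable _ _ drift _ c])
    show "0 \<le> potential_density M X q x" if "x > 0" for x
      using u(2) eq that by simp
  qed (simp_all add: ext u(4,6))
qed

end
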